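(* Let $\mathcal{G}$ be an ergodic $d$-regular Borel pmp graph on a standard probability space $(X,\mu)$, with Laplacian $L=L_{\mathcal{G}}$, and let $$m_L=\inf_{0\ne f\in L^2_0(X)}\frac{\langle Lf,f\rangle}{\langle f,f\rangle},\qquad M_L=\sup_{0\ne f\in L^2_0(X)}\frac{\langle Lf,f\rangle}{\langle f,f\rangle}.$$ If $2m_L\ge M_L$, then the strict measurable Tutte condition holds for $\mathcal{G}$.
   Context: A Borel graph on $X$ is a simple undirected graph with Borel edge set; $d$-regular means all degrees are $d$ (up to null sets). pmp: every partial Borel bijection of $X$ whose graph is contained in the connectedness relation of $\mathcal{G}$ preserves $\mu$. Ergodic: every measurable union of connected components has measure $0$ or $1$. $L_{\mathcal{G}}f(x)=\deg(x)f(x)-\sum_{y\sim x}f(y)$ on $L^2(X,\mu)$; $L^2_0(X)=\{f\in L^2(X):\int_X f\,d\mu=0\}$. For measurable $A\subseteq X$, let $\mathcal{O}_A$ be the set of $x\in X\setminus A$ lying in a finite connected component of odd size of the induced subgraph $\mathcal{G}\restriction(X\setminus A)$, and $\mathcal{O}_A^{(2k+1)}$ those lying in such a component of size $2k+1$. Define $\nu_A(Y)=\sum_{k\ge0}\frac{1}{2k+1}\mu(Y\cap\mathcal{O}_A^{(2k+1)})$ for $Y\subseteq\mathcal{O}_A$. $\mathcal{G}$ satisfies the strict measurable Tutte condition if there is $c<1$ such that $\nu_A(\mathcal{O}_A)\le c\,\mu(A)$ for every measurable $A\subseteq X$.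
   Formalization: The probability space is assumed atomless (with atoms the claim fails: the triangle with uniform measure and A empty); the Laplacian is evaluated pointwise on Borel functions, so a graph with uncountable degrees on a null set must first be altered there. *)

theory Defs
  imports "HOL-Probability.Probability"
begin

definition borel_graph :: "('a::polish_space \<Rightarrow> 'a \<Rightarrow> bool) \<Rightarrow> bool" where
  "borel_graph E \<longleftrightarrow> (\<forall>x y. E x y \<longrightarrow> E y x) \<and> (\<forall>x. \<not> E x x) \<and>
     {p. E (fst p) (snd p)} \<in> sets (borel \<Otimes>\<^sub>M borel)"

definition nbhd :: "('a \<Rightarrow> 'a \<Rightarrow> bool) \<Rightarrow> 'a \<Rightarrow> 'a set" where
  "nbhd E x = {y. E x y}"

definition deg :: "('a \<Rightarrow> 'a \<Rightarrow> bool) \<Rightarrow> 'a \<Rightarrow> nat" where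
  "deg E x = card (nbhd E x)"

definition regular_graph :: "'a measure \<Rightarrow> ('a \<Rightarrow> 'a \<Rightarrow> bool) \<Rightarrow> nat \<Rightarrow> bool" where
  "regular_graph M E d \<longleftrightarrow> (AE x in M. finite (nbhd E x) \<and> card (nbhd E x) = d)"

definition partial_borel_bij :: "'a measure \<Rightarrow> ('a \<Rightarrow> 'a) \<Rightarrow> 'a set \<Rightarrow> 'a set \<Rightarrow> bool" where
  "partial_borel_bij M \<phi> A B \<longleftrightarrow> A \<in> sets M \<and> B \<in> sets M \<and> bij_betw \<phi> A B \<and>
     (\<forall>C\<in>sets M. \<phi> -` C \<inter> A \<in> sets M) \<and> (\<forall>C\<in>sets M. C \<subseteq> A \<longrightarrow> \<phi> ` C \<in> sets M)"

definition pmp_graph :: "'a measure \<Rightarrow> ('a \<Rightarrow> 'a \<Rightarrow> bool) \<Rightarrow> bool" where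
  "pmp_graph M E \<longleftrightarrow> (\<forall>\<phi> A B. partial_borel_bij M \<phi> A B \<and> (\<forall>x\<in>A. E\<^sup>*\<^sup>* x (\<phi> x)) \<longrightarrow>
      (\<forall>C\<in>sets M. C \<subseteq> A \<longrightarrow> emeasure M (\<phi> ` C) = emeasure M C))"

definition ergodic_graph :: "'a measure \<Rightarrow> ('a \<Rightarrow> 'a \<Rightarrow> bool) \<Rightarrow> bool" where
  "ergodic_graph M E \<longleftrightarrow> (\<forall>S\<in>sets M. (\<forall>x y. E\<^sup>*\<^sup>* x y \<longrightarrow> (x \<in> S \<longleftrightarrow> y \<in> S)) \<longrightarrow>
      emeasure M S = 0 \<or> emeasure M S = 1)"

definition laplacian :: "('a \<Rightarrow> 'a \<Rightarrow> bool) \<Rightarrow> ('a \<Rightarrow> real) \<Rightarrow> 'a \<Rightarrow> real" where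
  "laplacian E f x = real (deg E x) * f x - (\<Sum>y\<in>nbhd E x. f y)"

definition L2_0_nonzero :: "'a measure \<Rightarrow> ('a \<Rightarrow> real) set" where
  "L2_0_nonzero M = {f. f \<in> borel_measurable M \<and> integrable M (\<lambda>x. (f x)\<^sup>2) \<and>
      (\<integral>x. f x \<partial>M) = 0 \<and> \<not> (AE x in M. f x = 0)}"

definition rayleigh_quotients :: "'a measure \<Rightarrow> ('a \<Rightarrow> 'a \<Rightarrow> bool) \<Rightarrow> real set" where
  "rayleigh_quotients M E = (\<lambda>f. (\<integral>x. laplacian E f x * f x \<partial>M) / (\<integral>x. (f x)\<^sup>2 \<partial>M)) ` L2_0_nonzero M"

definition m_L :: "'a measure \<Rightarrow> ('a \<Rightarrow> 'a \<Rightarrow> bool) \<Rightarrow> real" where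
  "m_L M E = Inf (rayleigh_quotients M E)"

definition M_L :: "'a measure \<Rightarrow> ('a \<Rightarrow> 'a \<Rightarrow> bool) \<Rightarrow> real" where
  "M_L M E = Sup (rayleigh_quotients M E)"

definition comp_outside :: "('a \<Rightarrow> 'a \<Rightarrow> bool) \<Rightarrow> 'a set \<Rightarrow> 'a \<Rightarrow> 'a set" where
  "comp_outside E A x = {y. (\<lambda>u v. E u v \<and> u \<notin> A \<and> v \<notin> A)\<^sup>*\<^sup>* x y}"

definition odd_comp_set :: "('a \<Rightarrow> 'a \<Rightarrow> bool) \<Rightarrow> 'a set \<Rightarrow> nat \<Rightarrow> 'a set" where
  "odd_comp_set E A k = {x. x \<notin> A \<and> finite (comp_outside E A x) \<and> card (comp_outside E A x) = 2*k+1}"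

definition nu_O :: "'a measure \<Rightarrow> ('a \<Rightarrow> 'a \<Rightarrow> bool) \<Rightarrow> 'a set \<Rightarrow> real" where
  "nu_O M E A = (\<Sum>k. (1 / real (2*k+1)) * measure M (odd_comp_set E A k))"

definition strict_measurable_tutte :: "'a measure \<Rightarrow> ('a \<Rightarrow> 'a \<Rightarrow> bool) \<Rightarrow> bool" where
  "strict_measurable_tutte M E \<longleftrightarrow> (\<exists>c<1. \<forall>A\<in>sets M. nu_O M E A \<le> c * measure M A)"

end

theory Submission
  imports Defs
begin

text \<open>If \<open>B\<close> and \<open>C\<close> are the two sides of a partition of the complement of \<open>A\<close> without edges between
  them, then Haemers' separation inequality and \<open>2 m\<^sub>L \<ge> M\<^sub>L\<close> give \<open>8 \<mu>(B) \<mu>(C) \<le> \<mu>(A)\<close>. Finite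
  components can be distributed freely over the two sides. If the odd components cover less than
  half of the complement of \<open>A\<close>, put them all into \<open>B\<close>; this gives \<open>\<nu>\<^sub>A \<le> \<mu>(A) / 2\<close>. Otherwise split the
  complement into equal halves; this gives \<open>\<mu>(A) \<ge> 1/2\<close>, and \<open>\<nu>\<^sub>A\<close> can then be close to \<open>\<mu>(A)\<close> only if
  there is an independent set of measure close to \<open>1/2\<close>. The test function of an independent set
  shows that its measure is at most \<open>1 - d / (2 m\<^sub>L)\<close>, which is less than \<open>1/2\<close> because \<open>m\<^sub>L < d\<close>:
  a set of small measure without isolated points has a Rayleigh quotient below \<open>d\<close>.

  All integrals rest on \<open>\<integral> \<Sum>\<^sub>y\<^sub>~\<^sub>x w(y) d\<mu> = d \<integral> w d\<mu>\<close>, obtained by writing almost all of the graph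
  as a union of partial Borel bijections. This needs the measurability of projections of Borel
  sets and the fact that almost no vertex is adjacent to a given null set.\<close>

section \<open>Projections of Borel sets\<close>

text \<open>The hypotheses control the graph only almost everywhere: in a null set a vertex may have
  uncountably many neighbours. A Borel choice of neighbours may therefore be uncountable-to-one over
  a null set, and \<open>pmp_graph\<close>, which speaks of partial bijections, does not apply to it
  directly. That the preimage is null all the same is the crux of the structural half; afterwards
  the bad set can be closed under adjacency and removed, and finite degrees make the rest explicit.
  In the spectral half the separation inequality reads
  \<open>b c / ((1 - b) (1 - c)) \<le> ((M - m) / (M + m))\<^sup>2\<close>. For
  \<open>M = 2 m\<close> the right side is \<open>1 / 9\<close>, and 8 is 9 - 1. At
  \<open>\<mu>(A) = 1 / 2\<close> and \<open>b = c = 1 / 4\<close> the result is an equality, which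
  a complement made of isolated vertices would match with \<open>\<nu> = \<mu>(A)\<close>. A
  constant below 1 thus needs a second ingredient, Hoffman's bound for independent sets.\<close>

lemma basis_sequence:
  obtains U :: "nat \<Rightarrow> 'a::second_countable_topology set"
  where "\<And>n. open (U n)" "\<And>x V. open V \<Longrightarrow> x \<in> V \<Longrightarrow> \<exists>n. x \<in> U n \<and> U n \<subseteq> V"
proof -
  obtain \<B> :: "'a set set" where \<B>: "countable \<B>" "topological_basis \<B>" using ex_countable_basis by blast
  have ne: "\<B> \<noteq> {}" using topological_basisE[OF \<B>(2), of UNIV] by (metis UNIV_I empty_iff open_UNIV)
  show ?thesis
  proof (rule that[of "from_nat_into \<B>"])
    show "open (from_nat_into \<B> n)" for n
      using \<B>(2) from_nat_into[OF ne] by (rule topological_basis_open)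
    show "\<exists>n. x \<in> from_nat_into \<B> n \<and> from_nat_into \<B> n \<subseteq> V" if "open V" "x \<in> V" for x V
      using topological_basisE[OF \<B>(2) that] from_nat_into_surj[OF \<B>(1)] by metis
  qed
qed

instance prod :: (polish_space, polish_space) polish_space ..

text \<open>Projections along Baire space, written \<open>nat \<Rightarrow> nat discrete\<close> so
  that the factor carries the product of discrete topologies. One factor suffices, since countably
  many sequences can be coded by one.\<close>

definition analytic :: "'a::topological_space set \<Rightarrow> bool" where
  "analytic S \<longleftrightarrow> (\<exists>F :: ('a \<times> (nat \<Rightarrow> nat discrete)) set. closed F \<and> S = fst ` F)"

lemma analytic_closed: "closed S \<Longrightarrow> analytic S"
  unfolding analytic_def by (rule exI[of _ "S \<times> UNIV"]) (auto intro: closed_Times)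

lemma continuous_on_reindex:
  "continuous_on UNIV (\<lambda>p::'a::topological_space \<times> (nat \<Rightarrow> 'b::topological_space). (fst p, \<lambda>k. snd p (f k)))"
proof (intro continuous_on_Pair continuous_on_fst continuous_on_id continuous_on_coordinatewise_then_product)
  fix k
  show "continuous_on UNIV (\<lambda>p::'a \<times> (nat \<Rightarrow> 'b). snd p (f k))"
    by (rule continuous_on_compose2[OF continuous_on_product_coordinates continuous_on_snd[OF continuous_on_id]]) auto
qed

lemma analytic_INT:
  assumes "\<And>n::nat. analytic (A n)"
  shows "analytic (\<Inter>n. A n)"
proof -
  obtain F :: "nat \<Rightarrow> ('a \<times> (nat \<Rightarrow> nat discrete)) set" where F: "\<And>n. closed (F n)" "\<And>n. A n = fst ` F n"
    using assms unfolding analytic_def by metis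
  \<comment> \<open>Column \<open>n\<close> of the code, read off by \<open>prod_encode\<close>, is
    the witness for \<open>A n\<close>.\<close>
  define G where "G = (\<Inter>n. (\<lambda>p::'a \<times> (nat \<Rightarrow> nat discrete). (fst p, \<lambda>k. snd p (prod_encode (n, k)))) -` F n)"
  have "closed G"
    unfolding G_def by (intro closed_INT ballI closed_vimage F continuous_on_reindex)
  moreover have "(\<Inter>n. A n) = fst ` G"
  proof (intro equalityI subsetI)
    fix x assume "x \<in> (\<Inter>n. A n)"
    then have "\<forall>n. \<exists>w. (x, w) \<in> F n" using F(2) by force
    then obtain w where w: "\<And>n. (x, w n) \<in> F n" by metis
    have "(x, \<lambda>i. case prod_decode i of (n, k) \<Rightarrow> w n k) \<in> G"
      unfolding G_def using w by simp
    then show "x \<in> fst ` G" by force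
  next
    fix x assume "x \<in> fst ` G"
    then show "x \<in> (\<Inter>n. A n)" unfolding G_def using F(2) by force
  qed
  ultimately show ?thesis unfolding analytic_def by blast
qed

lemma analytic_UN:
  assumes "\<And>n::nat. analytic (A n)"
  shows "analytic (\<Union>n. A n)"
proof -
  obtain F :: "nat \<Rightarrow> ('a \<times> (nat \<Rightarrow> nat discrete)) set" where F: "\<And>n. closed (F n)" "\<And>n. A n = fst ` F n"
    using assms unfolding analytic_def by metis
  \<comment> \<open>The first digit of the code names the set, the remaining ones are the witness.
    The first digit is locally constant, which keeps \<open>G\<close> closed.\<close>
  define h where "h = (\<lambda>p::'a \<times> (nat \<Rightarrow> nat discrete). (fst p, \<lambda>k. snd p (Suc k)))"
  define c where "c n = {p::'a \<times> (nat \<Rightarrow> nat discrete). snd p 0 = discrete n}" for n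
  have opc: "open (c n)" for n
  proof -
    have "c n = (\<lambda>p. snd p 0) -` {discrete n}" unfolding c_def by auto
    moreover have "continuous_on UNIV (\<lambda>p::'a \<times> (nat \<Rightarrow> nat discrete). snd p 0)"
      by (rule continuous_on_compose2[OF continuous_on_product_coordinates continuous_on_snd[OF continuous_on_id]]) auto
    ultimately show ?thesis by (simp add: open_vimage open_discrete)
  qed
  define G where "G = {p. h p \<in> F (of_discrete (snd p 0))}"
  have "- G = (\<Union>n. c n \<inter> h -` (- F n))"
    unfolding G_def c_def by (auto simp: of_discrete_inverse discrete_inverse)
  moreover have "open (h -` (- F n))" for n
    unfolding h_def by (intro open_vimage continuous_on_reindex) (use F in auto)
  ultimately have "closed G"
    unfolding closed_def using opc by (simp add: open_UN open_Int)
  moreover have "(\<Union>n. A n) = fst ` G"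
  proof (intro equalityI subsetI)
    fix x assume "x \<in> (\<Union>n. A n)"
    then obtain n w where w: "(x, w) \<in> F n" using F(2) by force
    have "(x, \<lambda>i. case i of 0 \<Rightarrow> discrete n | Suc k \<Rightarrow> w k) \<in> G"
      unfolding G_def h_def using w by (simp add: discrete_inverse)
    then show "x \<in> fst ` G" by force
  next
    fix x assume "x \<in> fst ` G"
    then show "x \<in> (\<Union>n. A n)" unfolding G_def h_def using F(2) by force
  qed
  ultimately show ?thesis unfolding analytic_def by blast
qed

lemma analytic_open:
  fixes S :: "'a::metric_space set"
  assumes "open S"
  shows "analytic S"
proof -
  have "fsigma_in euclidean S"
    using assms by (intro open_imp_fsigma_in metrizable_space_euclidean) auto
  then obtain C :: "nat \<Rightarrow> 'a set" where "\<And>n. closed (C n)" "\<Union>(range C) = S"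
    unfolding fsigma_in_ascending by (metis closed_closedin)
  with analytic_UN[of C] analytic_closed show ?thesis by metis
qed

text \<open>Complements of analytic sets need not be analytic, so the induction over the Borel sets
  carries a set together with its complement.\<close>

lemma analytic_borel:
  fixes S :: "'a::metric_space set"
  assumes "S \<in> sets borel"
  shows "analytic S"
proof -
  have "S \<in> sigma_sets UNIV (Collect closed)"
    using assms unfolding borel_eq_closed by simp
  then have "analytic S \<and> analytic (- S)"
  proof induction
    case (Basic a) then show ?case by (auto intro: analytic_closed analytic_open)
  next
    case Empty show ?case by (auto intro: analytic_closed)
  next
    case (Compl a) then show ?case by (auto simp: Compl_eq_Diff_UNIV double_diff)
  next
    case (Union a) then show ?case by (auto intro: analytic_UN analytic_INT)
  qed
  then show ?thesis ..
qed

text \<open>The tail from index \<open>k\<close> on is covered by finitely many balls of radius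
  \<open>1 / Suc k\<close>, and the finitely many earlier points are their own centres. So the range
  is totally bounded.\<close>

lemma convergent_subseq_finite_covers:
  fixes p e :: "nat \<Rightarrow> 'p::complete_space" and m :: "nat \<Rightarrow> nat"
  assumes "\<And>k n. k \<le> n \<Longrightarrow> p n \<in> (\<Union>j\<le>m k. cball (e j) (1 / Suc k))"
  obtains l r where "strict_mono (r::nat\<Rightarrow>nat)" "(p \<circ> r) \<longlonglongrightarrow> l"
proof -
  have "\<exists>K. finite K \<and> closure (range p) \<subseteq> (\<Union>x\<in>K. ball x \<epsilon>)" if \<epsilon>: "\<epsilon> > 0" for \<epsilon>
  proof -
    obtain k where k: "1 / Suc k < \<epsilon>" using \<epsilon> by (rule nat_approx_posE)
    define K where "K = p ` {..<k} \<union> e ` {..m k}"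
    have "range p \<subseteq> (\<Union>x\<in>K. cball x (1 / Suc k))"
    proof clarify
      fix n
      show "p n \<in> (\<Union>x\<in>K. cball x (1 / Suc k))"
      proof (cases "n < k")
        case True then show ?thesis unfolding K_def by (intro UN_I[of "p n"]) auto
      next
        case False with assms[of k n] show ?thesis unfolding K_def by auto
      qed
    qed
    moreover have "closed (\<Union>x\<in>K. cball x (1 / Suc k))" unfolding K_def by (intro closed_UN) auto
    ultimately have "closure (range p) \<subseteq> (\<Union>x\<in>K. cball x (1 / Suc k))" by (rule closure_minimal)
    also have "\<dots> \<subseteq> (\<Union>x\<in>K. ball x \<epsilon>)"
    proof (intro UN_mono order_refl subsetI)
      fix x y assume "y \<in> cball x (1 / Suc k)"
      then show "y \<in> ball x \<epsilon>" unfolding mem_ball mem_cball using k by linarith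
    qed
    finally have "closure (range p) \<subseteq> (\<Union>x\<in>K. ball x \<epsilon>)" .
    moreover have "finite K" unfolding K_def by simp
    ultimately show ?thesis by (intro exI[of _ K] conjI)
  qed
  then have "compact (closure (range p))"
    unfolding compact_eq_totally_bounded by (simp add: complete_eq_closed)
  then have "seq_compact (closure (range p))" by (simp add: compact_eq_seq_compact_metric)
  then show ?thesis
    using that closure_subset[of "range p"] unfolding seq_compact_def by (metis range_subsetD)
qed

text \<open>Choquet's capacitability argument. Restricting the fibre coordinate to a large finite
  union of small balls costs arbitrarily little outer measure, since outer measure is continuous
  along increasing unions. Done at every scale, this makes the remaining fibre totally bounded. The
  closures of the projections are measurable, and compactness shows that their intersection still
  lies in the projection.\<close>

lemma closed_projection_inner:
  fixes F :: "('a::metric_space \<times> 'p::polish_space) set"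
  assumes "finite_measure M" and sM: "sets M = sets borel" and "closed F" and c: "c < outer_measure_of M (fst ` F)"
  obtains D where "closed D" "D \<subseteq> fst ` F" "c \<le> emeasure M D"
proof -
  interpret finite_measure M by fact
  have spM: "space M = UNIV" using sets_eq_imp_space_eq[OF sM] by simp
  obtain E0 :: "'p set" where E0: "countable E0" "\<And>X. open X \<Longrightarrow> X \<noteq> {} \<Longrightarrow> \<exists>d\<in>E0. d \<in> X"
    by (rule countable_dense_setE) blast
  define e where "e = from_nat_into E0"
  have "E0 \<noteq> {}" using E0(2)[of UNIV] by auto
  have cov: "\<exists>j. x \<in> cball (e j) (1 / Suc k)" for x k
  proof -
    obtain d where "d \<in> E0" "d \<in> ball x (1 / Suc k)" using E0(2)[of "ball x (1 / Suc k)"] by auto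
    moreover then obtain j where "d = e j" unfolding e_def using E0(1) by (metis from_nat_into_surj)
    ultimately show ?thesis by (intro exI[of _ j]) (auto simp: dist_commute)
  qed
  define \<pi> where "\<pi> S = fst ` (F \<inter> UNIV \<times> S)" for S
  have "\<exists>f. \<forall>n. (c < outer_measure_of M (\<pi> (f n))) \<and>
      (\<exists>m::nat. f (Suc n) = f n \<inter> (\<Union>j\<le>m. cball (e j) (1 / Suc n)))"
  proof (rule dependent_nat_choice)
    show "\<exists>S. c < outer_measure_of M (\<pi> S)" using c unfolding \<pi>_def by (intro exI[of _ UNIV]) auto
  next
    fix S n assume S: "c < outer_measure_of M (\<pi> S)"
    define T where "T m = S \<inter> (\<Union>j\<le>m. cball (e j) (1 / Suc n))" for m :: nat
    have "(\<Union>m. T m) = S" unfolding T_def using cov[of _ n] by blast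
    then have "\<pi> S = (\<Union>m. \<pi> (T m))" unfolding \<pi>_def by blast
    moreover have "incseq (\<lambda>m. \<pi> (T m))" 
    proof (rule monoI)
      fix a b :: nat assume "a \<le> b"
      then have "T a \<subseteq> T b" unfolding T_def by fastforce
      then show "\<pi> (T a) \<subseteq> \<pi> (T b)" unfolding \<pi>_def by blast
    qed
    ultimately have "(SUP m. outer_measure_of M (\<pi> (T m))) = outer_measure_of M (\<pi> S)"
      using SUP_outer_measure_of_incseq[of "\<lambda>m. \<pi> (T m)" M] spM by simp
    then obtain m where "c < outer_measure_of M (\<pi> (T m))" using S by (metis less_SUP_iff)
    then show "\<exists>T. c < outer_measure_of M (\<pi> T) \<and> (\<exists>m::nat. T = S \<inter> (\<Union>j\<le>m. cball (e j) (1 / Suc n)))"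
      unfolding T_def by blast
  qed
  then obtain f m where f: "\<And>n. c < outer_measure_of M (\<pi> (f n))"
    "\<And>n. f (Suc n) = f n \<inter> (\<Union>j\<le>m n. cball (e j) (1 / Suc n))" by metis
  have decf: "decseq f" by (rule decseq_SucI) (use f in auto)
  have fm: "f (Suc n) \<subseteq> (\<Union>j\<le>m k. cball (e j) (1 / Suc k))" if "k \<le> n" for k n
    using decseqD[OF decf, of "Suc k" "Suc n"] that f(2)[of k] by auto
  define D where "D = (\<Inter>n. closure (\<pi> (f n)))"
  have "closed D" unfolding D_def by auto
  moreover have "D \<subseteq> fst ` F"
  proof
    fix x assume x: "x \<in> D"
    have "\<exists>q. q \<in> F \<and> snd q \<in> f (Suc n) \<and> dist (fst q) x < 1 / Suc n" for n
    proof -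
      have "x \<in> closure (\<pi> (f (Suc n)))" using x unfolding D_def by auto
      then obtain y where "y \<in> \<pi> (f (Suc n))" "dist y x < 1 / Suc n"
        unfolding closure_approachable by (metis of_nat_0_less_iff zero_less_Suc zero_less_divide_1_iff)
      then show ?thesis unfolding \<pi>_def by fastforce
    qed
    then obtain q where q: "\<And>n. q n \<in> F" "\<And>n. snd (q n) \<in> f (Suc n)" "\<And>n. dist (fst (q n)) x < 1 / Suc n" by metis
    have "snd (q n) \<in> (\<Union>j\<le>m k. cball (e j) (1 / Suc k))" if "k \<le> n" for k n
      using q(2)[of n] fm[OF that] by (rule rev_subsetD)
    from convergent_subseq_finite_covers[where p = "\<lambda>n. snd (q n)", OF this]
    obtain l r where r: "strict_mono (r::nat\<Rightarrow>nat)" "((\<lambda>n. snd (q n)) \<circ> r) \<longlonglongrightarrow> l"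
      by blast
    have "(\<lambda>n. fst (q n)) \<longlonglongrightarrow> x"
    proof (rule metric_LIMSEQ_I)
      fix r :: real assume "0 < r"
      then obtain k where k: "1 / Suc k < r" by (rule nat_approx_posE)
      have "dist (fst (q n)) x < r" if "n \<ge> k" for n
      proof -
        have "1 / Suc n \<le> 1 / Suc k" using that by (simp add: frac_le)
        with q(3)[of n] k show ?thesis by linarith
      qed
      then show "\<exists>no. \<forall>n\<ge>no. dist (fst (q n)) x < r" by blast
    qed
    then have "((\<lambda>n. fst (q n)) \<circ> r) \<longlonglongrightarrow> x" using r(1) by (rule LIMSEQ_subseq_LIMSEQ)
    then have "(\<lambda>n. (fst (q (r n)), snd (q (r n)))) \<longlonglongrightarrow> (x, l)"
      using r(2) by (intro tendsto_Pair) (auto simp: o_def)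
    then have "(x, l) \<in> F" 
      by (rule closed_sequentially[OF \<open>closed F\<close>, rotated]) (simp add: q(1))
    then show "x \<in> fst ` F" by force
  qed
  moreover have "c \<le> emeasure M D"
  proof -
    have "(INF n. emeasure M (closure (\<pi> (f n)))) = emeasure M (\<Inter>n. closure (\<pi> (f n)))"
    proof (rule INF_emeasure_decseq)
      show "decseq (\<lambda>n. closure (\<pi> (f n)))"
        using decf unfolding decseq_def \<pi>_def by (intro allI impI closure_mono image_mono) blast
    qed (auto simp: sM emeasure_finite)
    moreover have "c \<le> emeasure M (closure (\<pi> (f n)))" for n
    proof -
      have "outer_measure_of M (\<pi> (f n)) \<le> outer_measure_of M (closure (\<pi> (f n)))"
        by (intro outer_measure_of_mono closure_subset)
      also have "\<dots> = emeasure M (closure (\<pi> (f n)))" by (intro outer_measure_of_eq) (simp add: sM)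
      finally show ?thesis using f(1)[of n] by (meson dual_order.strict_trans1 less_imp_le)
    qed
    ultimately show ?thesis unfolding D_def by (metis INF_greatest)
  qed
  ultimately show ?thesis using that by blast
qed

text \<open>A projection of a Borel set is analytic, so it is measurable only for the completion of \<open>M\<close>.\<close>

lemma borel_projection_measurable:
  fixes C :: "('a::polish_space \<times> 'b::polish_space) set"
  assumes "finite_measure M" and sM: "sets M = sets borel" and C: "C \<in> sets borel"
  obtains L N where "L \<in> sets borel" "N \<in> null_sets M" "L \<subseteq> fst ` C" "fst ` C \<subseteq> L \<union> N"
proof -
  interpret finite_measure M by fact
  have spM: "space M = UNIV" using sets_eq_imp_space_eq[OF sM] by simp
  obtain F0 :: "(('a \<times> 'b) \<times> (nat \<Rightarrow> nat discrete)) set" where F0: "closed F0" "C = fst ` F0"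
    using analytic_borel[OF C] unfolding analytic_def by blast
  \<comment> \<open>The fibre \<open>'b\<close> and the code of the analytic set merge into one
    Polish fibre, so that two projections become one.\<close>
  define F where "F = (\<lambda>p::'a \<times> ('b \<times> (nat \<Rightarrow> nat discrete)). ((fst p, fst (snd p)), snd (snd p))) -` F0"
  have "closed F" unfolding F_def by (intro closed_vimage F0 continuous_intros)
  have FC: "fst ` F = fst ` C"
  proof (intro equalityI subsetI)
    fix x assume "x \<in> fst ` F"
    then obtain q where "((x, fst q), snd q) \<in> F0" unfolding F_def by auto
    then show "x \<in> fst ` C" unfolding F0(2) image_image by (rule rev_image_eqI) simp
  next
    fix x assume "x \<in> fst ` C"
    then obtain y w where "((x, y), w) \<in> F0" unfolding F0(2) by auto
    then have "(x, (y, w)) \<in> F" unfolding F_def by simp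
    then show "x \<in> fst ` F" by (rule rev_image_eqI) simp
  qed
  obtain U where U: "U \<in> sets M" "fst ` F \<subseteq> U" "outer_measure_of M (fst ` F) = emeasure M U"
    using outer_measure_of_attain[of "fst ` F" M] spM by auto
  have "\<exists>D. closed D \<and> D \<subseteq> fst ` F \<and> emeasure M U \<le> emeasure M D + ennreal (1 / Suc n)" for n
  proof (cases "emeasure M U = 0")
    case True then show ?thesis by (intro exI[of _ "{}"]) auto
  next
    case False
    then have "emeasure M U - ennreal (1 / Suc n) < emeasure M U"
      by (intro ennreal_between) (auto simp: less_top[symmetric] zero_less_iff_neq_zero)
    then obtain D where D: "closed D" "D \<subseteq> fst ` F" "emeasure M U - ennreal (1 / Suc n) \<le> emeasure M D"
      using closed_projection_inner[OF assms(1) sM \<open>closed F\<close>, of "emeasure M U - ennreal (1 / Suc n)"] unfolding U(3)[symmetric] by metis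
    then show ?thesis by (auto simp: ennreal_minus_le_iff add.commute)
  qed
  then obtain D where D: "\<And>n. closed (D n)" "\<And>n. D n \<subseteq> fst ` F"
    "\<And>n::nat. emeasure M U \<le> emeasure M (D n) + ennreal (1 / Suc n)" by metis
  define L where "L = (\<Union>n. D n)"
  have L: "L \<in> sets borel" "L \<subseteq> fst ` F" unfolding L_def using D by auto
  have "emeasure M U \<le> emeasure M L"
  proof (rule ennreal_le_epsilon)
    fix \<epsilon> :: real assume "0 < \<epsilon>"
    then obtain n where n: "1 / Suc n < \<epsilon>" by (rule nat_approx_posE)
    have "emeasure M U \<le> emeasure M (D n) + ennreal (1 / Suc n)" by (rule D)
    also have "\<dots> \<le> emeasure M L + ennreal \<epsilon>"
      by (intro add_mono emeasure_mono ennreal_leI) (use n L sM in \<open>auto simp: L_def\<close>)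
    finally show "emeasure M U \<le> emeasure M L + ennreal \<epsilon>" .
  qed
  moreover have "emeasure M (U - L) = emeasure M U - emeasure M L"
    using L U by (intro emeasure_Diff) (auto simp: sM emeasure_finite)
  ultimately have "emeasure M (U - L) = 0" by (simp add: diff_eq_0_iff_ennreal less_top[symmetric])
  then have "U - L \<in> null_sets M" using U L sM by auto
  moreover have "fst ` C \<subseteq> L \<union> (U - L)" using U FC by auto
  ultimately show ?thesis using that[of L "U - L"] L FC by auto
qed

section \<open>Measure-preserving connectedness relations\<close>

primrec branch :: "('s \<Rightarrow> nat \<Rightarrow> 'b \<Rightarrow> 's) \<Rightarrow> 's \<Rightarrow> (nat \<Rightarrow> 'b) \<Rightarrow> nat \<Rightarrow> 's" where
  "branch h s c 0 = s"
| "branch h s c (Suc k) = h (branch h s c k) k (c k)"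

lemma branch_cong: "(\<And>i. i < k \<Longrightarrow> c i = c' i) \<Longrightarrow> branch h s c k = branch h s c' k"
  by (induction k) auto

locale pmp_polish = prob_space M for M :: "'a::polish_space measure" +
  fixes E :: "'a \<Rightarrow> 'a \<Rightarrow> bool"
  assumes sets_M: "sets M = sets borel" and sym_E: "E x y \<Longrightarrow> E y x" and pmp: "pmp_graph M E"
begin

lemma space_M: "space M = UNIV"
  using sets_eq_imp_space_eq[OF sets_M] by simp

lemma conn_sym: "E\<^sup>*\<^sup>* x y \<Longrightarrow> E\<^sup>*\<^sup>* y x"
  using sym_E by (metis sympD sympI symp_rtranclp)

text \<open>Inner regularity of the push-forward of \<open>M\<close> to the graph. A compact piece
  of the graph is worth more than a compact subset of \<open>S\<close>: on it \<open>g\<close> is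
  continuous and, if injective, has a continuous inverse.\<close>

lemma graph_inner_regular:
  fixes g :: "'a \<Rightarrow> 'a"
  assumes S: "S \<in> sets borel" and g: "g \<in> borel_measurable borel" and c: "c < emeasure M S"
  obtains K where "compact K" "K \<subseteq> (\<lambda>x. (x, g x)) ` S" "c < emeasure M (fst ` K)"
proof -
  define h where "h x = (x, g x)" for x
  have h: "h \<in> measurable M borel"
    unfolding h_def borel_prod[symmetric] using g sets_M by (intro measurable_Pair) (auto simp: measurable_cong_sets[OF sets_M refl])
  define \<Gamma> where "\<Gamma> = h ` S"
  have \<Gamma>: "\<Gamma> = (\<lambda>p. (g (fst p), snd p)) -` {q. fst q = snd q} \<inter> fst -` S"
    unfolding \<Gamma>_def h_def by force
  have m: "(\<lambda>p::'a\<times>'a. (g (fst p), snd p)) \<in> borel \<rightarrow>\<^sub>M borel"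
    unfolding borel_prod[symmetric] using g by measurable
  have "closed {q::'a\<times>'a. fst q = snd q}"
    by (intro closed_Collect_eq continuous_intros)
  then have "(\<lambda>p::'a\<times>'a. (g (fst p), snd p)) -` {q. fst q = snd q} \<inter> space borel \<in> sets borel"
    by (intro measurable_sets[OF m]) auto
  moreover have "(fst :: 'a\<times>'a \<Rightarrow> 'a) -` S \<inter> space borel \<in> sets borel"
    by (intro measurable_sets[OF _ S] borel_measurable_continuous_onI continuous_intros)
  ultimately have \<Gamma>b: "\<Gamma> \<in> sets borel" unfolding \<Gamma> by auto
  interpret D: prob_space "distr M borel h" by (rule prob_space_distr[OF h])
  have "emeasure (distr M borel h) \<Gamma> = (SUP K \<in> {K. K \<subseteq> \<Gamma> \<and> compact K}. emeasure (distr M borel h) K)"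
    by (rule inner_regular) (auto simp: \<Gamma>b D.emeasure_space_1)
  moreover have "h -` \<Gamma> = S" unfolding \<Gamma>_def h_def by auto
  ultimately have "c < (SUP K \<in> {K. K \<subseteq> \<Gamma> \<and> compact K}. emeasure (distr M borel h) K)"
    using c by (simp add: emeasure_distr h \<Gamma>b space_M)
  then obtain K where K: "K \<subseteq> \<Gamma>" "compact K" "c < emeasure (distr M borel h) K"
    unfolding less_SUP_iff by blast
  have "h -` K = fst ` K" using K(1) unfolding \<Gamma>_def h_def by force
  moreover have "K \<in> sets borel" using K(2) by (intro borel_closed compact_imp_closed)
  ultimately have "c < emeasure M (fst ` K)" using K(3) by (simp add: emeasure_distr h space_M)
  with K show ?thesis using that unfolding \<Gamma>_def h_def by blast
qed

text \<open>Invariance is assumed for bijections with Borel images, a property that must first be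
  secured for \<open>g\<close>. On a compact piece of the graph the second projection is a
  homeomorphism, so images become preimages; if the inequality failed, such a piece would outweigh
  \<open>T\<close>.\<close>

lemma emeasure_le_of_inj_on:
  assumes S: "S \<in> sets borel" and g: "g \<in> borel_measurable borel" and inj: "inj_on g S"
    and conn: "\<And>x. x \<in> S \<Longrightarrow> E\<^sup>*\<^sup>* x (g x)" and T: "T \<in> sets borel" and im: "g ` S \<subseteq> T"
  shows "emeasure M S \<le> emeasure M T"
proof (rule ccontr)
  assume "\<not> emeasure M S \<le> emeasure M T"
  then have "emeasure M T < emeasure M S" by simp
  then obtain K where K: "compact K" "K \<subseteq> (\<lambda>x. (x, g x)) ` S" "emeasure M T < emeasure M (fst ` K)"
    using graph_inner_regular[OF S g] by blast
  define A where "A = fst ` K"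
  define B where "B = snd ` K"
  have c: "compact A" "compact B" unfolding A_def B_def
    by (intro compact_continuous_image continuous_intros K)+
  have gA: "(x, g x) \<in> K" if "x \<in> A" for x using K(2) that unfolding A_def by auto
  have AS: "A \<subseteq> S" using K(2) unfolding A_def by auto
  have gAB: "g ` A = B" using gA K(2) unfolding A_def B_def by force
  have "inj_on snd K"
  proof (rule inj_onI)
    fix p q assume pq: "p \<in> K" "q \<in> K" "snd p = snd q"
    then obtain x y where "p = (x, g x)" "x \<in> S" "q = (y, g y)" "y \<in> S" using K(2) by blast
    with pq inj_onD[OF inj, of x y] show "p = q" by simp
  qed
  then have "\<exists>\<psi>. homeomorphism K B snd \<psi>"
    unfolding B_def by (intro homeomorphism_compact[OF K(1) _ refl] continuous_intros)
  then obtain \<psi> where \<psi>: "homeomorphism K B snd \<psi>" by blast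
  have inv: "fst (\<psi> (g x)) = x" if "x \<in> A" for x
    using \<psi> gA[OF that] unfolding homeomorphism_def by (metis fst_conv snd_conv)
  have "continuous_on B (\<lambda>y. fst (\<psi> y))"
    using \<psi> unfolding homeomorphism_def by (intro continuous_intros) auto
  then have mi: "(\<lambda>y. fst (\<psi> y)) \<in> borel_measurable (restrict_space borel B)"
    by (rule borel_measurable_continuous_on_restrict)
  have Bb: "B \<in> sets borel" and Ab: "A \<in> sets borel" using c by (auto intro: borel_closed compact_imp_closed)
  have img: "g ` C \<in> sets borel" if "C \<in> sets borel" "C \<subseteq> A" for C
  proof -
    have "g ` C = (\<lambda>y. fst (\<psi> y)) -` C \<inter> B"
      using that inv gAB by (force simp: image_iff)
    also have "\<dots> \<in> sets borel"
      using measurable_sets[OF mi that(1)] Bb by (auto simp: space_restrict_space sets_restrict_space_iff)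
    finally show ?thesis .
  qed
  have "partial_borel_bij M g A B"
    unfolding partial_borel_bij_def sets_M
  proof (intro conjI ballI impI)
    show "bij_betw g A B" unfolding bij_betw_def using gAB inj AS by (auto intro: inj_on_subset)
    show "g -` C \<inter> A \<in> sets borel" if "C \<in> sets borel" for C
      using measurable_sets[OF g that] Ab by auto
  qed (use Ab Bb img in auto)
  then have "emeasure M (g ` A) = emeasure M A"
    using pmp AS conn Ab sets_M unfolding pmp_graph_def by blast
  moreover have "emeasure M (g ` A) \<le> emeasure M T"
    by (intro emeasure_mono) (use AS im T sets_M in auto)
  ultimately show False using K(3) unfolding A_def by simp
qed

text \<open>\<open>Z\<close> stands for the points whose \<open>f\<close>-fibre meets
  \<open>C\<close> in positive conditional measure. Instead of a disintegration it uses a density: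
  that of the image of \<open>M\<close> restricted to \<open>C\<close> with respect to the image of
  \<open>M\<close>, and \<open>Z\<close> is where this is nonzero.\<close>

lemma essential_image:
  fixes f :: "'a \<Rightarrow> 'a"
  assumes f: "f \<in> borel_measurable borel" and C: "C \<in> sets borel"
  obtains Z where "Z \<in> sets borel"
    "\<And>Y. Y \<in> sets borel \<Longrightarrow> C \<inter> f -` Y \<in> null_sets M \<longleftrightarrow> f -` (Y \<inter> Z) \<in> null_sets M"
proof -
  have f': "f \<in> measurable M borel" using f by (simp add: measurable_cong_sets[OF sets_M refl])
  have C': "C \<in> sets M" using C sets_M by simp
  have pre: "f -` Y \<in> sets M" if "Y \<in> sets borel" for Y using measurable_sets[OF f' that] by (simp add: space_M)
  define \<nu> where "\<nu> = distr M borel f"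
  define \<nu>C where "\<nu>C = distr (density M (indicator C)) borel f"
  interpret \<nu>: prob_space \<nu> unfolding \<nu>_def by (rule prob_space_distr[OF f'])
  have f'': "f \<in> measurable (density M (indicator C)) borel" using f' by simp
  have n1: "Y \<in> null_sets \<nu> \<longleftrightarrow> f -` Y \<in> null_sets M" if "Y \<in> sets borel" for Y
    unfolding \<nu>_def null_sets_distr_iff[OF f'] using that pre by (simp add: space_M)
  have n2: "Y \<in> null_sets \<nu>C \<longleftrightarrow> C \<inter> f -` Y \<in> null_sets M" if "Y \<in> sets borel" for Y
    unfolding \<nu>C_def null_sets_distr_iff[OF f''] using that pre[OF that] C'
    by (auto simp: space_M null_sets_def emeasure_restricted)
  have ac: "absolutely_continuous \<nu> \<nu>C"
    unfolding absolutely_continuous_def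
  proof
    fix Y assume "Y \<in> null_sets \<nu>"
    moreover then have Y: "Y \<in> sets borel" unfolding \<nu>_def by auto
    ultimately have "f -` Y \<in> null_sets M" using n1 by simp
    then have "C \<inter> f -` Y \<in> null_sets M" using C' by (rule null_set_Int1)
    then show "Y \<in> null_sets \<nu>C" using n2[OF Y] by simp
  qed
  have sets: "sets \<nu>C = sets \<nu>" "sets \<nu> = sets borel" unfolding \<nu>C_def \<nu>_def by auto
  define \<rho> where "\<rho> = RN_deriv \<nu> \<nu>C"
  have \<rho>: "\<rho> \<in> borel_measurable \<nu>" "density \<nu> \<rho> = \<nu>C"
    unfolding \<rho>_def using \<nu>.density_RN_deriv[OF ac sets(1)] by auto
  define Z where "Z = {z. \<rho> z \<noteq> 0}"
  have "{z \<in> space \<nu>. \<rho> z \<noteq> 0} \<in> sets \<nu>" using \<rho>(1) by measurable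
  then have Z: "Z \<in> sets borel" unfolding Z_def \<nu>_def by simp
  have "C \<inter> f -` Y \<in> null_sets M \<longleftrightarrow> f -` (Y \<inter> Z) \<in> null_sets M" if Y: "Y \<in> sets borel" for Y
  proof -
    have "C \<inter> f -` Y \<in> null_sets M \<longleftrightarrow> Y \<in> null_sets (density \<nu> \<rho>)" using n2[OF Y] \<rho>(2) by simp
    also have "\<dots> \<longleftrightarrow> (AE z in \<nu>. z \<in> Y \<longrightarrow> \<rho> z = 0)"
      using null_sets_density_iff[OF \<rho>(1)] Y sets by simp
    also have "\<dots> \<longleftrightarrow> (AE z in \<nu>. z \<notin> Y \<inter> Z)" unfolding Z_def by (intro AE_cong) auto
    also have "\<dots> \<longleftrightarrow> Y \<inter> Z \<in> null_sets \<nu>"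
      using AE_iff_null_sets[of "Y \<inter> Z" \<nu>] Y Z sets by auto
    also have "\<dots> \<longleftrightarrow> f -` (Y \<inter> Z) \<in> null_sets M" using n1 Y Z by auto
    finally show ?thesis .
  qed
  with Z show ?thesis using that by blast
qed

text \<open>If \<open>f -` N\<close> had positive measure, then by \<open>emeasure_le_of_inj_on\<close> it would be injective on no
  positive part of it, so almost every fibre carries a tree of sets of positive conditional measure
  that never stops splitting. Following the branch coded by a bit \<open>b\<close> and the bits
  \<open>x \<in> U 0, x \<in> U 1, \<dots>\<close> gives, for the two values of \<open>b\<close>, two injections of the same set into
  itself with disjoint images, both preserving the measure.\<close>

lemma null_preimage:
  fixes f :: "'a \<Rightarrow> 'a"
  assumes f: "f \<in> borel_measurable borel" and conn: "\<And>x. E\<^sup>*\<^sup>* x (f x)" and N: "N \<in> null_sets M"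
  shows "f -` N \<in> null_sets M"
proof (rule ccontr)
  assume not_null: "f -` N \<notin> null_sets M"
  have Nb: "N \<in> sets borel" using N sets_M by auto
  have pre: "f -` Y \<in> sets borel" if "Y \<in> sets borel" for Y
    using measurable_sets[OF f that] by simp
  have inj_null: "S \<in> null_sets M" if S: "S \<in> sets borel" "S \<subseteq> f -` N" "inj_on f S" for S
  proof -
    have "emeasure M S \<le> emeasure M N"
      by (rule emeasure_le_of_inj_on[OF S(1) f S(3) conn Nb]) (use S(2) in auto)
    then show ?thesis using N S(1) sets_M by (auto simp: null_sets_def)
  qed
  have "0 < emeasure M (f -` N)"
    using not_null pre[OF Nb] sets_M by (auto simp: null_sets_def zero_less_iff_neq_zero)
  then obtain G where G: "compact G" "G \<subseteq> (\<lambda>x. (x, f x)) ` (f -` N)" "0 < emeasure M (fst ` G)"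
    using graph_inner_regular[OF pre[OF Nb] f] by blast
  define K where "K = fst ` G"
  have K: "compact K" "K \<subseteq> f -` N" using G unfolding K_def
    by (auto intro!: compact_continuous_image continuous_intros)
  have GK: "(x, y) \<in> G \<longleftrightarrow> x \<in> K \<and> y = f x" for x y using G(2) unfolding K_def by force
  have Kb: "K \<in> sets borel" using K(1) by (intro borel_closed compact_imp_closed)

  obtain U :: "nat \<Rightarrow> 'a set" where U: "\<And>n. open (U n)"
    and basis: "\<And>x V. open V \<Longrightarrow> x \<in> V \<Longrightarrow> \<exists>n. x \<in> U n \<and> U n \<subseteq> V"
    by (rule basis_sequence, rule that, assumption, assumption)

  \<comment> \<open>Nodes of the tree are lists of indices of basic sets, newest first; closures
    keep the pieces compact.\<close>
  define C where "C l = K \<inter> (\<Inter>i\<in>set l. closure (U i))" for l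
  have Cc: "closed (C l)" for l unfolding C_def using K(1) by (intro closed_Int compact_imp_closed) auto
  have Cb: "C l \<in> sets borel" for l using Cc by auto
  have CK: "C l \<subseteq> K" for l unfolding C_def by auto
  have CCons: "C (i # l) = C l \<inter> closure (U i)" for i l unfolding C_def by auto
  have "\<exists>Z. Z \<in> sets borel \<and> (\<forall>Y\<in>sets borel. C l \<inter> f -` Y \<in> null_sets M \<longleftrightarrow> f -` (Y \<inter> Z) \<in> null_sets M)" for l
    using essential_image[OF f Cb] by metis
  then obtain Z where Zb: "\<And>l. Z l \<in> sets borel"
    and Z: "\<And>l Y. Y \<in> sets borel \<Longrightarrow> C l \<inter> f -` Y \<in> null_sets M \<longleftrightarrow> f -` (Y \<inter> Z l) \<in> null_sets M"
    by metis
  have Z_compl: "C l \<inter> f -` (- Z l) \<in> null_sets M" for l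
    using Z[of "- Z l" l] Zb[of l] by auto

  \<comment> \<open>Disjoint closures let the limit point betray the branch taken; the diameter
    bounds make every branch converge.\<close>
  define small where "small k i j \<longleftrightarrow> closure (U i) \<inter> closure (U j) = {} \<and>
    (\<forall>x\<in>closure (U i). \<forall>y\<in>closure (U i). dist x y \<le> 1 / Suc k) \<and>
    (\<forall>x\<in>closure (U j). \<forall>y\<in>closure (U j). dist x y \<le> 1 / Suc k)" for k i j
  have small: "\<exists>i j. x \<in> U i \<and> y \<in> U j \<and> small k i j" if "x \<noteq> y" for x y k
  proof -
    define r where "r = min (dist x y / 3) (1 / Suc k / 2)"
    have r: "r > 0" "3 * r \<le> dist x y" "2 * r \<le> 1 / Suc k" using that unfolding r_def by (auto simp: min_def field_simps)
    obtain i where i: "x \<in> U i" "U i \<subseteq> ball x r" using basis[of "ball x r" x] r by auto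
    obtain j where j: "y \<in> U j" "U j \<subseteq> ball y r" using basis[of "ball y r" y] r by auto
    have ci: "closure (U i) \<subseteq> cball x r" using i(2) by (intro closure_minimal) (auto intro: less_imp_le)
    have cj: "closure (U j) \<subseteq> cball y r" using j(2) by (intro closure_minimal) (auto intro: less_imp_le)
    have "dist a b \<le> 1 / Suc k" if "a \<in> cball c r" "b \<in> cball c r" for a b c :: 'a
      using that r(3) dist_triangle[of a b c] by (simp add: dist_commute)
    moreover have "cball x r \<inter> cball y r = {}"
    proof -
      have False if "dist x a \<le> r" "dist y a \<le> r" for a
        using that r dist_triangle[of x y a] by (simp add: dist_commute)
      then show ?thesis by auto
    qed
    ultimately have "small k i j" unfolding small_def using ci cj by blast
    with i j show ?thesis by blast
  qed

  \<comment> \<open>Node \<open>l\<close> splits over \<open>z\<close> at level \<open>k\<close> if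
    two separated children both carry positive conditional measure in the fibre of
    \<open>z\<close>.\<close>
  define split where "split z l k n \<longleftrightarrow> (case prod_decode n of (i, j) \<Rightarrow>
    small k i j \<and> z \<in> Z (i # l) \<and> z \<in> Z (j # l))" for z l k n
  have split_pred: "Measurable.pred borel (\<lambda>z. split z l k n)" for l k n
  proof (cases "prod_decode n")
    case (Pair i j)
    have "{z \<in> space borel. split z l k n} = (if small k i j then Z (i # l) \<inter> Z (j # l) else {})"
      unfolding split_def Pair by auto
    then show ?thesis unfolding pred_def using Zb by auto
  qed
  define N1 where "N1 l = Z l - f ` C l" for l
  define N2 where "N2 l k = Z l \<inter> {z. \<forall>n. \<not> split z l k n}" for l k
  have fC: "f ` C l \<in> sets borel" for l
  proof -
    have "f ` C l = snd ` (G \<inter> C l \<times> UNIV)" using CK[of l] by (force simp: GK image_iff)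
    also have "compact \<dots>"
      by (intro compact_continuous_image continuous_intros compact_Int_closed G closed_Times Cc closed_UNIV closed_singleton)
    finally show ?thesis by (intro borel_closed compact_imp_closed)
  qed
  have N1b: "N1 l \<in> sets borel" for l unfolding N1_def using Zb fC by auto
  have N2b: "N2 l k \<in> sets borel" for l k
  proof -
    have "{z \<in> space borel. \<forall>n. \<not> split z l k n} \<in> sets borel"
      using split_pred by measurable
    then show ?thesis unfolding N2_def using Zb by auto
  qed
  have N1: "f -` N1 l \<in> null_sets M" for l
  proof -
    have "C l \<inter> f -` (- (f ` C l)) = {}" by auto
    then have "f -` (- (f ` C l) \<inter> Z l) \<in> null_sets M" using Z[of "- (f ` C l)" l] fC by auto
    moreover have "- (f ` C l) \<inter> Z l = N1 l" unfolding N1_def by auto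
    ultimately show ?thesis by simp
  qed
  \<comment> \<open>Two points of \<open>S\<close> with the same image would lie in small separated
    basic sets that are both essential over this image, and so provide a splitting. Hence
    \<open>f\<close> is injective on \<open>S\<close>, which makes \<open>S\<close> null.\<close>
  have N2: "f -` N2 l k \<in> null_sets M" for l k
  proof -
    define S where "S = (C l \<inter> f -` N2 l k) - (\<Union>i. C (i # l) \<inter> f -` (- Z (i # l)))"
    have Sb: "S \<in> sets borel" unfolding S_def using Cb N2b Zb pre by auto
    have "inj_on f S"
    proof (rule inj_onI, rule ccontr)
      fix x y assume xy: "x \<in> S" "y \<in> S" "f x = f y" "x \<noteq> y"
      obtain i j where ij: "x \<in> U i" "y \<in> U j" "small k i j" using small[OF xy(4)] by blast
      have "f x \<in> Z (i # l)" "f y \<in> Z (j # l)"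
        using xy(1,2) ij closure_subset[of "U i"] closure_subset[of "U j"] unfolding S_def CCons by auto
      then have "split (f x) l k (prod_encode (i, j))" unfolding split_def using ij xy(3) by simp
      then show False using xy(1) unfolding S_def N2_def by auto
    qed
    then have "S \<in> null_sets M" using Sb K(2) CK[of l] unfolding S_def by (intro inj_null) (auto simp: S_def)
    moreover have "(\<Union>i. C (i # l) \<inter> f -` (- Z (i # l))) \<in> null_sets M"
      by (intro null_sets_UN Z_compl)
    ultimately have "S \<union> (\<Union>i. C (i # l) \<inter> f -` (- Z (i # l))) \<in> null_sets M" by (rule null_sets.Un)
    then have "C l \<inter> f -` N2 l k \<in> null_sets M"
      by (rule null_sets_subset) (use Cb N2b pre sets_M in \<open>auto simp: S_def\<close>)
    then have "f -` (N2 l k \<inter> Z l) \<in> null_sets M" using Z N2b by blast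
    moreover have "N2 l k \<inter> Z l = N2 l k" unfolding N2_def by auto
    ultimately show ?thesis by simp
  qed

  define N0 where "N0 = (\<Union>l. N1 l) \<union> (\<Union>l k. N2 l k)"
  \<comment> \<open>\<open>S\<close> is \<open>K\<close> cut down by conditions on
    \<open>f x\<close> alone, so a map of \<open>S\<close> into \<open>K\<close> that preserves
    \<open>f\<close> stays in \<open>S\<close>.\<close>
  define S where "S = (K \<inter> f -` Z []) - f -` N0"
  have N0b: "N0 \<in> sets borel" unfolding N0_def using N1b N2b by auto
  have Sb: "S \<in> sets borel" unfolding S_def using Kb Zb N0b pre by auto
  have "f -` N0 = (\<Union>l. f -` N1 l) \<union> (\<Union>l k. f -` N2 l k)" unfolding N0_def by auto
  also have "\<dots> \<in> null_sets M" by (intro null_sets.Un null_sets_UN N1 N2)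
  finally have "f -` N0 \<in> null_sets M" .
  moreover have "K - f -` Z [] \<in> null_sets M"
    using Z_compl[of "[]"] by (simp add: C_def Diff_eq vimage_Compl)
  ultimately have "f -` N0 \<union> (K - f -` Z []) \<in> null_sets M" by (rule null_sets.Un)
  moreover have "K \<subseteq> S \<union> (f -` N0 \<union> (K - f -` Z []))" unfolding S_def by auto
  ultimately have "emeasure M K \<le> emeasure M S"
    using Sb sets_M by (metis Un_commute emeasure_Un_null_set emeasure_mono null_setsD2 sets.Un)
  then have posS: "0 < emeasure M S" using G(3) unfolding K_def by simp

  define pick where "pick z l k = prod_decode (LEAST n. split z l k n)" for z l k
  have pick: "small k (fst (pick z l k)) (snd (pick z l k)) \<and> z \<in> Z (fst (pick z l k) # l) \<and> z \<in> Z (snd (pick z l k) # l)"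
    if "z \<in> Z l" "z \<notin> N0" for z l k
  proof -
    have "\<exists>n. split z l k n" using that unfolding N0_def N2_def by auto
    then have "split z l k (LEAST n. split z l k n)" by (rule LeastI_ex)
    then show ?thesis unfolding split_def pick_def by (simp add: case_prod_unfold)
  qed
  define child where "child z l k t = (if t then fst (pick z l k) else snd (pick z l k)) # l" for z l k and t :: bool
  \<comment> \<open>Digit 0 is left free to distinguish the two maps; the later digits determine
    \<open>x\<close>, since basic sets separate points.\<close>
  define bits where "bits b x n = (case n of 0 \<Rightarrow> b | Suc m \<Rightarrow> x \<in> U m)" for b x and n :: nat
  define node where "node b x = branch (child (f x)) [] (bits b x)" for b x
  have bits_inj: "b = b' \<and> x = y" if "bits b x = bits b' y" for b b' x y
  proof -
    have "b = b'" using fun_cong[OF that, of 0] unfolding bits_def by simp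
    moreover have "x \<in> U m \<longleftrightarrow> y \<in> U m" for m using fun_cong[OF that, of "Suc m"] unfolding bits_def by simp
    then have "x = y" using small[of x y 0] closure_subset unfolding small_def by blast
    ultimately show ?thesis by simp
  qed
  have node_Z: "f x \<in> Z (node b x k)" if "x \<in> S" for b x k
  proof (induction k)
    case 0 show ?case using that unfolding node_def S_def by simp
  next
    case (Suc k)
    then show ?case
      using pick[of "f x" "node b x k" k] that unfolding node_def S_def child_def by auto
  qed
  have node_Suc: "node b x (Suc k) = child (f x) (node b x k) k (bits b x k)" for b x k
    unfolding node_def by simp
  have node_small: "dist y y' \<le> 1 / Suc k" if "x \<in> S" "y \<in> C (node b x (Suc k))" "y' \<in> C (node b x (Suc k))" for x y y' b k
    using pick[OF node_Z[OF that(1), of b k], of k] that unfolding node_Suc child_def CCons small_def S_def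
    by (auto split: if_splits)
  have ex_g0: "\<exists>y. \<forall>k. y \<in> C (node b x k) \<and> f y = f x" if x: "x \<in> S" for b x
  proof -
    \<comment> \<open>The shift by one skips the root, whose diameter is not controlled. What
      follows is Cantor's intersection theorem within the fibre.\<close>
    define D where "D k = C (node b x (Suc k)) \<inter> f -` {f x}" for k
    have "\<exists>y. \<forall>k. y \<in> D k"
    proof (rule decreasing_closed_nest)
      show "closed (D k)" for k
      proof -
        have "D k = fst ` (G \<inter> C (node b x (Suc k)) \<times> {f x})"
          using CK[of "node b x (Suc k)"] unfolding D_def by (force simp: GK image_iff)
        also have "compact \<dots>"
          by (intro compact_continuous_image continuous_intros compact_Int_closed G closed_Times Cc closed_UNIV closed_singleton)
        finally show ?thesis by (rule compact_imp_closed)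
      qed
      show "D k \<noteq> {}" for k
      proof -
        have "f x \<in> f ` C (node b x (Suc k))"
          using node_Z[OF x, of b "Suc k"] x unfolding S_def N0_def N1_def by auto
        then obtain y where "y \<in> C (node b x (Suc k))" "f y = f x" by auto
        then show ?thesis unfolding D_def by auto
      qed
      have "decseq D" by (rule decseq_SucI) (auto simp: D_def node_Suc child_def CCons)
      then show "D n \<subseteq> D m" if "m \<le> n" for m n using that by (rule decseqD)
      fix e :: real assume "e > 0"
      then obtain k where k: "1 / Suc k < e" by (rule nat_approx_posE)
      have "dist y y' < e" if "y \<in> D k" "y' \<in> D k" for y y'
        using node_small[OF x, of y b k y'] that k unfolding D_def by auto
      then show "\<exists>n. \<forall>y\<in>D n. \<forall>y'\<in>D n. dist y y' < e" by blast
    qed blast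
    then obtain y where "\<And>k. y \<in> D k" by blast
    then have "y \<in> C (node b x (Suc k)) \<and> f y = f x" for k unfolding D_def by auto
    moreover have "C (node b x (Suc k)) \<subseteq> C (node b x k)" for k by (auto simp: node_Suc child_def CCons)
    ultimately show ?thesis by blast
  qed
  define g0 where "g0 b x = (SOME y. \<forall>k. y \<in> C (node b x k) \<and> f y = f x)" for b x
  have g0: "g0 b x \<in> C (node b x k)" "f (g0 b x) = f x" if "x \<in> S" for b x k
    using someI_ex[OF ex_g0[OF that, of b]] unfolding g0_def by auto
  define g where "g b x = (if x \<in> S then g0 b x else x)" for b x
  \<comment> \<open>Equal values have equal \<open>f\<close>-images, so both codes are read in the
    same tree; at the first differing digit they enter children with disjoint closures.\<close>
  have g_inj: "b = b' \<and> x = y" if xy: "x \<in> S" "y \<in> S" and eq: "g b x = g b' y" for b b' x y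
  proof (rule ccontr)
    assume "\<not> (b = b' \<and> x = y)"
    then have "\<exists>n. bits b x n \<noteq> bits b' y n" using bits_inj by blast
    define n where "n = (LEAST n. bits b x n \<noteq> bits b' y n)"
    have n: "bits b x n \<noteq> bits b' y n" "\<And>i. i < n \<Longrightarrow> bits b x i = bits b' y i"
      unfolding n_def using LeastI_ex[OF \<open>\<exists>n. bits b x n \<noteq> bits b' y n\<close>] not_less_Least by blast+
    have fxy: "f x = f y" using g0(2) xy eq unfolding g_def by metis
    have same: "node b' y n = node b x n" unfolding node_def fxy using n(2) by (intro branch_cong) auto
    define p where "p = pick (f x) (node b x n) n"
    have "closure (U (fst p)) \<inter> closure (U (snd p)) = {}"
      using pick[OF node_Z[OF xy(1), of b n]] xy(1) unfolding small_def p_def S_def by auto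
    moreover have "g b x \<in> closure (U (if bits b x n then fst p else snd p))"
      using g0(1)[OF xy(1), of b "Suc n"] xy(1) unfolding g_def node_Suc child_def CCons p_def by auto
    moreover have "g b x \<in> closure (U (if bits b' y n then fst p else snd p))"
      using g0(1)[OF xy(2), of b' "Suc n"] xy(2) eq unfolding g_def node_Suc child_def CCons p_def same fxy by auto
    ultimately show False using n(1) by (auto split: if_splits)
  qed
  have pick_meas: "(\<lambda>x. pick (f x) l k) \<in> borel \<rightarrow>\<^sub>M count_space UNIV" for l k
    unfolding pick_def
  proof (rule measurable_compose[OF f])
    show "(\<lambda>z. prod_decode (LEAST n. split z l k n)) \<in> borel \<rightarrow>\<^sub>M count_space UNIV"
      by (rule measurable_compose[OF measurable_Least[OF split_pred]]) simp
  qed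
  have bits_meas: "Measurable.pred borel (\<lambda>x. bits b x n)" for b n
    unfolding bits_def using U by (cases n) (auto intro!: pred_sets2[of _ borel] borel_open)
  have node_meas: "(\<lambda>x. node b x k) \<in> borel \<rightarrow>\<^sub>M count_space UNIV" for b k
  proof (induction k)
    case 0 show ?case unfolding node_def by simp
  next
    case (Suc k)
    show ?case unfolding node_Suc
    proof (rule measurable_compose_countable[OF _ Suc])
      fix l
      have "(\<lambda>x. h (pick (f x) l k)) \<in> borel \<rightarrow>\<^sub>M count_space UNIV" for h :: "nat \<times> nat \<Rightarrow> nat list"
        by (rule measurable_compose[OF pick_meas]) simp
      from measurable_If[OF this[of "\<lambda>p. fst p # l"] this[of "\<lambda>p. snd p # l"], of "\<lambda>x. bits b x k"]
      have "(\<lambda>x. if bits b x k then fst (pick (f x) l k) # l else snd (pick (f x) l k) # l) \<in> borel \<rightarrow>\<^sub>M count_space UNIV"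
        using bits_meas by (simp add: pred_def)
      also have "(\<lambda>x. if bits b x k then fst (pick (f x) l k) # l else snd (pick (f x) l k) # l) =
          (\<lambda>x. child (f x) l k (bits b x k))"
        unfolding child_def by auto
      finally show "(\<lambda>x. child (f x) l k (bits b x k)) \<in> borel \<rightarrow>\<^sub>M count_space UNIV" .
    qed
  qed
  have node_set: "{x. P (node b x k)} \<in> sets borel" for b k and P :: "nat list \<Rightarrow> bool"
    using measurable_sets[OF node_meas[of b k], of "Collect P"] by (simp add: vimage_def)
  have g_meas: "g b \<in> borel_measurable borel" for b
  proof (rule borel_measurableI)
    fix V :: "'a set" assume V: "open V"
    \<comment> \<open>On \<open>S\<close> the nodes shrink to the value, which therefore lies in the
      open set \<open>V\<close> exactly if some node does.\<close>
    have "g b -` V = (S \<inter> (\<Union>k. {x. C (node b x k) \<subseteq> V})) \<union> (V - S)"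
    proof (intro equalityI subsetI)
      fix x assume x: "x \<in> g b -` V"
      show "x \<in> (S \<inter> (\<Union>k. {x. C (node b x k) \<subseteq> V})) \<union> (V - S)"
      proof (cases "x \<in> S")
        case True
        then have "g0 b x \<in> V" using x unfolding g_def by simp
        then obtain e where e: "e > 0" "ball (g0 b x) e \<subseteq> V" using V open_contains_ball by metis
        obtain k where k: "1 / Suc k < e" using e(1) by (rule nat_approx_posE)
        have "y \<in> V" if "y \<in> C (node b x (Suc k))" for y
          using node_small[OF True g0(1)[OF True] that] e(2) k by (auto simp: subset_iff)
        then show ?thesis using True by blast
      qed (use x in \<open>auto simp: g_def\<close>)
    next
      fix x assume "x \<in> (S \<inter> (\<Union>k. {x. C (node b x k) \<subseteq> V})) \<union> (V - S)"
      then show "x \<in> g b -` V" using g0(1) unfolding g_def by auto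
    qed
    also have "\<dots> \<in> sets borel" using Sb V node_set by auto
    finally show "g b -` V \<inter> space borel \<in> sets borel" by simp
  qed
  have gS: "g b x \<in> S" if "x \<in> S" for b x
    using g0(1)[OF that, of b 0] g0(2)[OF that, of b] CK[of "node b x 0"] that unfolding g_def S_def by auto
  have g_conn: "E\<^sup>*\<^sup>* x (g b x)" if "x \<in> S" for b x
    using conn[of x] conn_sym[OF conn[of "g0 b x"]] g0(2)[OF that, of b] that unfolding g_def by auto
  \<comment> \<open>The first node depends on \<open>y\<close> only through \<open>f y\<close> and
    on the digit \<open>b\<close>. Hence a point and its image under \<open>g b\<close> have the
    same first node, and the image falls into \<open>T b\<close>.\<close>
  define T where "T b = {y \<in> S. y \<in> C (node b y 1)}" for b
  have node1: "node b y 1 = child (f y) [] 0 b" for b y unfolding node_def bits_def by simp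
  have Tb: "T b \<in> sets borel" for b
  proof -
    have "T b = (\<Union>l. S \<inter> C l \<inter> {y. node b y 1 = l})" unfolding T_def by auto
    also have "\<dots> \<in> sets borel"
      using Sb Cb node_set[of "\<lambda>l'. l' = l" for l] by (intro sets.countable_UN) auto
    finally show ?thesis .
  qed
  have "T True \<inter> T False = {}"
  proof -
    have False if "y \<in> T True" "y \<in> T False" for y
      using that pick[of "f y" "[]" 0] unfolding T_def node1 child_def CCons small_def S_def by auto
    then show ?thesis by auto
  qed
  have "emeasure M S \<le> emeasure M (T b)" for b
  proof (rule emeasure_le_of_inj_on[OF Sb g_meas _ g_conn Tb])
    show "inj_on (g b) S" using g_inj by (auto intro: inj_onI)
    show "g b ` S \<subseteq> T b"
    proof
      fix y assume "y \<in> g b ` S"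
      then obtain x where x: "x \<in> S" "y = g b x" by auto
      have "f y = f x" using x g0(2) unfolding g_def by simp
      then have "node b y 1 = node b x 1" unfolding node1 by simp
      then show "y \<in> T b" unfolding T_def using x gS g0(1)[OF x(1), of b 1] by (auto simp: g_def)
    qed
  qed
  then have "emeasure M S + emeasure M S \<le> emeasure M (T True) + emeasure M (T False)"
    by (intro add_mono)
  also have "\<dots> = emeasure M (T True \<union> T False)"
    using \<open>T True \<inter> T False = {}\<close> Tb sets_M by (intro plus_emeasure) auto
  also have "\<dots> \<le> emeasure M S"
    using Sb sets_M by (intro emeasure_mono) (auto simp: T_def)
  finally have "measure M S + measure M S \<le> measure M S"
    unfolding emeasure_eq_measure by (simp flip: ennreal_plus)
  with posS show False unfolding emeasure_eq_measure by simp
qed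

end

section \<open>Decomposition into partial Borel bijections\<close>

lemma borel_Collect_eq:
  fixes f g :: "'a::topological_space \<Rightarrow> 'b::polish_space"
  assumes "f \<in> borel_measurable borel" "g \<in> borel_measurable borel"
  shows "{x. f x = g x} \<in> sets borel"
proof -
  have "(\<lambda>x. (f x, g x)) \<in> borel \<rightarrow>\<^sub>M borel"
    unfolding borel_prod[symmetric] using assms by measurable
  moreover have "closed {q::'b\<times>'b. fst q = snd q}"
    by (intro closed_Collect_eq continuous_intros)
  ultimately have "(\<lambda>x. (f x, g x)) -` {q. fst q = snd q} \<inter> space borel \<in> sets borel"
    by (intro measurable_sets) auto
  then show ?thesis by (simp add: vimage_def)
qed

locale regular_pmp_graph = pmp_polish M E for M :: "'a::polish_space measure" and E +
  fixes d :: nat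
  assumes borel_E: "{p. E (fst p) (snd p)} \<in> sets borel"
    and irrefl_E: "\<not> E x x"
    and regular: "AE x in M. finite (nbhd E x) \<and> card (nbhd E x) = d"
begin

text \<open>Given a Borel left inverse, images are Borel preimages: \<open>y\<close> lies in the
  image of \<open>C\<close> iff \<open>\<psi> y\<close> lies in \<open>C\<close> and
  \<open>\<phi> (\<psi> y) = y\<close>.\<close>

lemma emeasure_image_of_inverse:
  assumes A: "A \<in> sets borel" and \<phi>: "\<phi> \<in> borel_measurable borel" and \<psi>: "\<psi> \<in> borel_measurable borel"
    and inv: "\<And>x. x \<in> A \<Longrightarrow> \<psi> (\<phi> x) = x" and conn: "\<And>x. x \<in> A \<Longrightarrow> E\<^sup>*\<^sup>* x (\<phi> x)"
    and C: "C \<in> sets borel" "C \<subseteq> A"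
  shows "\<phi> ` C \<in> sets borel" "emeasure M (\<phi> ` C) = emeasure M C"
proof -
  have img: "\<phi> ` C \<in> sets borel" if C: "C \<in> sets borel" "C \<subseteq> A" for C
  proof -
    have "\<phi> ` C = \<psi> -` C \<inter> {y. \<phi> (\<psi> y) = y}" using C(2) inv by (force simp: image_iff)
    moreover have "{y. \<phi> (\<psi> y) = y} \<in> sets borel"
      by (intro borel_Collect_eq measurable_compose[OF \<psi> \<phi>]) simp
    ultimately show ?thesis using measurable_sets[OF \<psi> C(1)] by auto
  qed
  show "\<phi> ` C \<in> sets borel" by (rule img[OF C])
  have "inj_on \<phi> A" using inv by (metis inj_onI)
  then have "partial_borel_bij M \<phi> A (\<phi> ` A)"
    unfolding partial_borel_bij_def sets_M using A img[OF A] img measurable_sets[OF \<phi>]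
    by (auto simp: bij_betw_def)
  then show "emeasure M (\<phi> ` C) = emeasure M C"
    using pmp conn C sets_M unfolding pmp_graph_def by blast
qed

end

text \<open>The orbit decomposition in the style of Lusin and Novikov, modulo null sets: over \<open>X0\<close> the
  oriented edges are the disjoint union of the graphs of the partial bijections \<open>\<phi> i\<close> on \<open>D i\<close>.
  That \<open>X0\<close> is closed under \<open>E\<close> is essential, since \<^const>\<open>laplacian\<close> sees null sets.\<close>

locale structured_graph = regular_pmp_graph M E d for M :: "'a::polish_space measure" and E d +
  fixes X0 :: "'a set" and D :: "nat \<Rightarrow> 'a set" and \<phi> :: "nat \<Rightarrow> 'a \<Rightarrow> 'a"
  assumes X0_borel: "X0 \<in> sets borel" and X0_conull: "- X0 \<in> null_sets M"
    and X0_deg: "x \<in> X0 \<Longrightarrow> finite (nbhd E x) \<and> card (nbhd E x) = d"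
    and X0_closed: "x \<in> X0 \<Longrightarrow> E x y \<Longrightarrow> y \<in> X0"
    and D_borel: "D i \<in> sets borel" and D_X0: "D i \<subseteq> X0"
    and \<phi>_borel: "\<phi> i \<in> borel_measurable borel" and \<phi>_inj: "inj_on (\<phi> i) (D i)"
    and \<phi>_image: "C \<in> sets borel \<Longrightarrow> C \<subseteq> D i \<Longrightarrow> \<phi> i ` C \<in> sets borel \<and> emeasure M (\<phi> i ` C) = emeasure M C"
    and E_iff: "x \<in> X0 \<Longrightarrow> E x y \<longleftrightarrow> (\<exists>i. x \<in> D i \<and> \<phi> i x = y)"
    and D_unique: "x \<in> D i \<Longrightarrow> x \<in> D j \<Longrightarrow> \<phi> i x = \<phi> j x \<Longrightarrow> i = j"

context regular_pmp_graph
begin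

text \<open>Almost every vertex has finitely many neighbours, so each of them is its only neighbour
  in some \<open>U n\<close>. These unique neighbours are Borel functions of the vertex, because
  projections are measurable up to null sets. An arc is labelled by one such function leading along
  it and one leading back.\<close>

lemma exists_structured_graph: "\<exists>X0 D \<phi>. structured_graph M E d X0 D \<phi>"
proof -
  obtain U :: "nat \<Rightarrow> 'a set" where U: "\<And>n. open (U n)"
    and basis: "\<And>x V. open V \<Longrightarrow> x \<in> V \<Longrightarrow> \<exists>n. x \<in> U n \<and> U n \<subseteq> V"
    by (rule basis_sequence, rule that, assumption, assumption)
  define P where "P V = {x. nbhd E x \<inter> V \<noteq> {}}" for V
  have "\<exists>L N. L \<in> sets borel \<and> N \<in> null_sets M \<and> L \<subseteq> P (U n) \<and> P (U n) \<subseteq> L \<union> N" for n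
  proof -
    have "(snd :: 'a \<times> 'a \<Rightarrow> 'a) -` U n \<in> sets borel"
      using U[of n] by (intro borel_open open_vimage continuous_intros)
    then have "{p. E (fst p) (snd p)} \<inter> snd -` U n \<in> sets borel"
      using borel_E by auto
    moreover have "fst ` ({p. E (fst p) (snd p)} \<inter> snd -` U n) = P (U n)"
      unfolding P_def nbhd_def by (auto simp: image_iff Bex_def)
    ultimately show ?thesis
      using borel_projection_measurable[OF finite_measure_axioms sets_M,
        of "{p. E (fst p) (snd p)} \<inter> snd -` U n"] by (metis (no_types))
  qed
  then obtain L Nl where L: "\<And>n. L n \<in> sets borel" "\<And>n. Nl n \<in> null_sets M"
    "\<And>n. L n \<subseteq> P (U n)" "\<And>n. P (U n) \<subseteq> L n \<union> Nl n" by metis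
  obtain Nr where Nr: "Nr \<in> null_sets M" "{x. \<not> (finite (nbhd E x) \<and> card (nbhd E x) = d)} \<subseteq> Nr"
    using regular unfolding eventually_ae_filter space_M by auto
  define N0 where "N0 = Nr \<union> (\<Union>n. Nl n)"
  have N0: "N0 \<in> null_sets M" unfolding N0_def using Nr L by (intro null_sets.Un null_sets_UN)
  then have N0b: "N0 \<in> sets borel" using sets_M by auto
  have fin: "finite (nbhd E x)" if "x \<notin> N0" for x using that Nr unfolding N0_def by auto
  have P: "P V - N0 \<in> sets borel" if V: "open V" for V
  proof -
    have "P V - N0 = (\<Union>n\<in>{n. U n \<subseteq> V}. L n - N0)"
    proof (intro equalityI subsetI)
      fix x assume x: "x \<in> P V - N0"
      then obtain y where y: "y \<in> nbhd E x" "y \<in> V" unfolding P_def by auto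
      then obtain n where n: "y \<in> U n" "U n \<subseteq> V" using basis[OF V] by blast
      then have "x \<in> P (U n)" unfolding P_def using y by auto
      then have "x \<in> L n" using L(4)[of n] x unfolding N0_def by auto
      then show "x \<in> (\<Union>n\<in>{n. U n \<subseteq> V}. L n - N0)" using n x by auto
    qed (use L(3) in \<open>force simp: P_def\<close>)
    then show ?thesis using L(1) N0b by auto
  qed
  define A where "A n = {x. \<exists>y. nbhd E x \<inter> U n = {y}} - N0" for n
  have A: "A n \<in> sets borel" for n
  proof -
    \<comment> \<open>A second neighbour in \<open>U n\<close> means that two disjoint basic subsets
      of \<open>U n\<close> both meet the neighbourhood, a countable condition.\<close>
    have "A n = (P (U n) - N0) - (\<Union>(i,j)\<in>{(i,j). U i \<inter> U j = {} \<and> U i \<subseteq> U n \<and> U j \<subseteq> U n}. (P (U i) - N0) \<inter> (P (U j) - N0))"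
      (is "_ = ?R")
    proof (intro equalityI subsetI)
      fix x assume "x \<in> A n"
      then obtain y where y: "nbhd E x \<inter> U n = {y}" "x \<notin> N0" unfolding A_def by auto
      then have "x \<in> P (U n)" unfolding P_def by auto
      moreover have "y \<in> V" if "V \<subseteq> U n" "x \<in> P V" for V using y(1) that unfolding P_def by auto
      then have "\<not> (x \<in> P V \<and> x \<in> P W)" if "V \<inter> W = {}" "V \<subseteq> U n" "W \<subseteq> U n" for V W
        using that by blast
      ultimately show "x \<in> ?R" using y(2) by auto
    next
      fix x assume x: "x \<in> ?R"
      then obtain y where y: "y \<in> nbhd E x" "y \<in> U n" unfolding P_def by auto
      have "z = y" if z: "z \<in> nbhd E x" "z \<in> U n" for z
      proof (rule ccontr)
        assume "z \<noteq> y"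
        then obtain V W where VW: "open V" "open W" "z \<in> V" "y \<in> W" "V \<inter> W = {}" using hausdorff by metis
        obtain i where i: "z \<in> U i" "U i \<subseteq> V \<inter> U n" using basis[of "V \<inter> U n" z] VW U z by auto
        obtain j where j: "y \<in> U j" "U j \<subseteq> W \<inter> U n" using basis[of "W \<inter> U n" y] VW U y by auto
        have "U i \<inter> U j = {}" "U i \<subseteq> U n" "U j \<subseteq> U n" using i j VW by auto
        moreover have "x \<in> P (U i)" "x \<in> P (U j)" unfolding P_def using i j y z by auto
        ultimately show False using x by auto
      qed
      then have "nbhd E x \<inter> U n = {y}" using y by blast
      then show "x \<in> A n" unfolding A_def using x by auto
    qed
    moreover have "(\<Union>(i,j)\<in>{(i,j). U i \<inter> U j = {} \<and> U i \<subseteq> U n \<and> U j \<subseteq> U n}. (P (U i) - N0) \<inter> (P (U j) - N0)) \<in> sets borel"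
      using P[OF U] by (intro sets.countable_UN') auto
    ultimately show ?thesis using P[OF U] by auto
  qed
  define \<theta> where "\<theta> n x = (if x \<in> A n then THE y. y \<in> nbhd E x \<inter> U n else x)" for n x
  have \<theta>: "nbhd E x \<inter> U n = {\<theta> n x}" if "x \<in> A n" for n x
  proof -
    obtain y where y: "nbhd E x \<inter> U n = {y}" using \<open>x \<in> A n\<close> unfolding A_def by auto
    then have "\<theta> n x = y" unfolding \<theta>_def using that by simp
    then show ?thesis using y by simp
  qed
  have \<theta>E: "E x (\<theta> n x)" if "x \<in> A n" for n x using \<theta>[OF that] unfolding nbhd_def by blast
  have \<theta>_meas: "\<theta> n \<in> borel_measurable borel" for n
  proof (rule borel_measurableI)
    fix V :: "'a set" assume V: "open V"
    have PV: "x \<in> P (U n \<inter> V) \<longleftrightarrow> \<theta> n x \<in> V" if "x \<in> A n" for x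
      using \<theta>[OF that] unfolding P_def by (simp add: Int_assoc[symmetric])
    have "x \<in> \<theta> n -` V \<longleftrightarrow> x \<in> (A n \<inter> (P (U n \<inter> V) - N0)) \<union> (V - A n)" for x
    proof (cases "x \<in> A n")
      case True
      moreover then have "x \<notin> N0" unfolding A_def by simp
      ultimately show ?thesis using PV[OF True] by simp
    next
      case False then show ?thesis unfolding \<theta>_def by simp
    qed
    then have "\<theta> n -` V = (A n \<inter> (P (U n \<inter> V) - N0)) \<union> (V - A n)" by blast
    also have "\<dots> \<in> sets borel" using A P[of "U n \<inter> V"] U V by (auto simp: open_Int)
    finally show "\<theta> n -` V \<inter> space borel \<in> sets borel" by simp
  qed
  have \<theta>_ex: "\<exists>n. x \<in> A n \<and> \<theta> n x = y" if "x \<notin> N0" "E x y" for x y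
  proof -
    have "open (- (nbhd E x - {y}))" using fin[OF that(1)] by (intro open_Compl finite_imp_closed) auto
    then obtain n where n: "y \<in> U n" "U n \<subseteq> - (nbhd E x - {y})" using basis by blast
    then have "nbhd E x \<inter> U n = {y}" using that(2) unfolding nbhd_def by auto
    moreover then have "x \<in> A n" unfolding A_def using that by auto
    ultimately show ?thesis using \<theta>[of x n] by auto
  qed

  \<comment> \<open>The bad set is enlarged again and again by every point that some
    \<open>\<theta> n\<close> sends into it. Each round stays null by \<open>null_preimage\<close>,
    and in the limit no vertex outside is adjacent to the bad set.\<close>
  define Nn where "Nn = rec_nat N0 (\<lambda>_ N. N \<union> (\<Union>n. \<theta> n -` N))"
  have Nn: "Nn k \<in> null_sets M" for k
  proof (induction k)
    case 0 show ?case unfolding Nn_def using N0 by simp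
  next
    case (Suc k)
    have "\<theta> n -` Nn k \<in> null_sets M" for n
    proof (rule null_preimage[OF \<theta>_meas _ Suc])
      show "E\<^sup>*\<^sup>* x (\<theta> n x)" for x using \<theta>E[of x n] by (cases "x \<in> A n") (auto simp: \<theta>_def)
    qed
    with Suc show ?case unfolding Nn_def by (auto intro!: null_sets.Un null_sets_UN)
  qed
  define X0 where "X0 = - (\<Union>k. Nn k)"
  have "N0 \<subseteq> (\<Union>k. Nn k)" using UN_upper[of 0 UNIV Nn] unfolding Nn_def by simp
  then have X0N: "x \<notin> N0" if "x \<in> X0" for x using that unfolding X0_def by auto
  have null: "- X0 \<in> null_sets M" unfolding X0_def by (auto intro: Nn)
  then have X0b: "X0 \<in> sets borel" using sets_M by (metis double_complement null_setsD2 sets.compl_sets space_M Compl_eq_Diff_UNIV)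
  have X0E: "y \<in> X0" if x: "x \<in> X0" and E: "E x y" for x y
  proof (rule ccontr)
    assume "y \<notin> X0"
    then obtain k where k: "y \<in> Nn k" unfolding X0_def by auto
    obtain n where "x \<in> A n" "\<theta> n x = y" using \<theta>_ex[OF X0N[OF x] E] by blast
    then have "x \<in> Nn (Suc k)" using k unfolding Nn_def by auto
    then show False using x unfolding X0_def by auto
  qed

  define \<phi> where "\<phi> i = \<theta> (fst (prod_decode i))" for i
  define \<psi> where "\<psi> i = \<theta> (snd (prod_decode i))" for i
  \<comment> \<open>The code \<open>i\<close> names a map out and a map back; requiring that they
    compose to the identity gives \<open>\<phi> i\<close> a Borel left inverse.\<close>
  define D0 where "D0 i = X0 \<inter> A (fst (prod_decode i)) \<inter> \<phi> i -` A (snd (prod_decode i)) \<inter> {x. \<psi> i (\<phi> i x) = x}" for i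
  \<comment> \<open>An arc is kept only under its least label, so that sums over \<open>i\<close>
    count it once.\<close>
  define D where "D i = D0 i - (\<Union>j<i. D0 j \<inter> {x. \<phi> j x = \<phi> i x})" for i
  have m: "\<phi> i \<in> borel_measurable borel" "\<psi> i \<in> borel_measurable borel" for i
    unfolding \<phi>_def \<psi>_def by (rule \<theta>_meas)+
  have D0b: "D0 i \<in> sets borel" for i
  proof -
    have "\<phi> i -` A (snd (prod_decode i)) \<in> sets borel"
      using measurable_sets[OF m(1) A] by simp
    moreover have "{x. \<psi> i (\<phi> i x) = x} \<in> sets borel"
      by (intro borel_Collect_eq measurable_compose[OF m(1) m(2)]) simp
    ultimately show ?thesis unfolding D0_def using X0b A by (intro sets.Int)
  qed
  have Db: "D i \<in> sets borel" for i
  proof -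
    have "D0 j \<inter> {x. \<phi> j x = \<phi> i x} \<in> sets borel" for j
      by (intro sets.Int D0b borel_Collect_eq m)
    then show ?thesis unfolding D_def using D0b by (intro sets.Diff sets.countable_UN') auto
  qed
  have inv: "\<psi> i (\<phi> i x) = x" if "x \<in> D i" for i x using that unfolding D_def D0_def by auto
  have DX0: "D i \<subseteq> X0" for i unfolding D_def D0_def by auto
  have DE: "E x (\<phi> i x)" if "x \<in> D i" for i x using that \<theta>E unfolding D_def D0_def \<phi>_def by auto
  have D_ex: "\<exists>i. x \<in> D i \<and> \<phi> i x = y" if x: "x \<in> X0" and E: "E x y" for x y
  proof -
    obtain n where n: "x \<in> A n" "\<theta> n x = y" using \<theta>_ex[OF X0N[OF x] E] by blast
    obtain k where k: "y \<in> A k" "\<theta> k y = x" using \<theta>_ex[OF X0N[OF X0E[OF x E]] sym_E[OF E]] by blast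
    define Q where "Q i \<longleftrightarrow> x \<in> D0 i \<and> \<phi> i x = y" for i
    have "Q (prod_encode (n, k))" unfolding Q_def D0_def \<phi>_def \<psi>_def using n k x by simp
    then have Q: "Q (LEAST i. Q i)" by (rule LeastI)
    have nQ: "\<not> Q j" if "j < (LEAST i. Q i)" for j using that by (rule not_less_Least)
    define i where "i = (LEAST i. Q i)"
    have "x \<in> D0 i" "\<phi> i x = y" using Q unfolding i_def Q_def by auto
    moreover have "\<not> (x \<in> D0 j \<and> \<phi> j x = y)" if "j < i" for j using nQ that unfolding i_def Q_def by blast
    ultimately have "x \<in> D i \<and> \<phi> i x = y" unfolding D_def by auto
    then show ?thesis by blast
  qed
  have uniq: "i = j" if "x \<in> D i" "x \<in> D j" "\<phi> i x = \<phi> j x" for x i j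
    using that by (cases i j rule: linorder_cases) (auto simp: D_def)
  have "structured_graph M E d X0 D \<phi>"
  proof unfold_locales
    show "finite (nbhd E x) \<and> card (nbhd E x) = d" if "x \<in> X0" for x
      using X0N[OF that] Nr unfolding N0_def by auto
    show "inj_on (\<phi> i) (D i)" for i using inv by (metis inj_onI)
    show "\<phi> i ` C \<in> sets borel \<and> emeasure M (\<phi> i ` C) = emeasure M C" if "C \<in> sets borel" "C \<subseteq> D i" for i C
    proof -
      have "E\<^sup>*\<^sup>* x (\<phi> i x)" if "x \<in> D i" for x using DE[OF that] by (rule r_into_rtranclp)
      from emeasure_image_of_inverse[OF Db m(1) m(2) inv this that] show ?thesis by blast
    qed
    show "E x y \<longleftrightarrow> (\<exists>i. x \<in> D i \<and> \<phi> i x = y)" if "x \<in> X0" for x y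
      using D_ex[OF that] DE by auto
  qed (use X0b null X0E Db DX0 m uniq in auto)
  then show ?thesis by blast
qed

end

section \<open>Energy and Rayleigh quotients\<close>

text \<open>With ternary weights the first differing digit contributes \<open>(1/3) ^ n\<close>, and
  all later ones together at most half of that. Binary weights would identify \<open>0111...\<close>
  with \<open>1000...\<close>.\<close>

lemma ternary_sum_inj:
  fixes f g :: "nat \<Rightarrow> bool"
  assumes eq: "(\<Sum>k. of_bool (f k) * (1/3::real) ^ k) = (\<Sum>k. of_bool (g k) * (1/3) ^ k)"
  shows "f = g"
proof (rule ccontr)
  assume "f \<noteq> g"
  then have ex: "\<exists>n. f n \<noteq> g n" by auto
  define n where "n = (LEAST n. f n \<noteq> g n)"
  have n: "f n \<noteq> g n" unfolding n_def using ex by (rule LeastI_ex)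
  have less: "f k = g k" if "k < n" for k using not_less_Least that unfolding n_def by blast
  have geo: "summable (\<lambda>k. (1/3::real) ^ k)" by (intro summable_geometric) simp
  have sm: "summable (\<lambda>k. of_bool (h k) * (1/3::real) ^ k)" for h :: "nat \<Rightarrow> bool"
    by (rule summable_comparison_test'[OF geo]) auto
  define a where "a k = (of_bool (f k) - of_bool (g k)) * (1/3::real) ^ k" for k
  have a: "a k = of_bool (f k) * (1/3) ^ k - of_bool (g k) * (1/3) ^ k" for k
    unfolding a_def by (simp add: left_diff_distrib)
  have sa: "summable a" unfolding a[abs_def] by (intro summable_diff sm)
  have "suminf a = 0" unfolding a[abs_def] using eq suminf_diff[OF sm sm, of f g] by simp
  moreover have "suminf a = (\<Sum>k. a (k + Suc n)) + (\<Sum>k<Suc n. a k)"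
    by (rule suminf_split_initial_segment[OF sa])
  moreover have "(\<Sum>k<Suc n. a k) = a n" using less unfolding a_def by (simp add: lessThan_Suc)
  moreover have "\<bar>a n\<bar> = (1/3) ^ n" using n unfolding a_def by (cases "f n"; cases "g n") auto
  moreover have "\<bar>\<Sum>k. a (k + Suc n)\<bar> \<le> (1/3) ^ n / 2"
  proof -
    have sg: "(\<lambda>k. (1/3::real) ^ (k + Suc n)) sums ((1/3) ^ n / 2)"
      using sums_mult[OF geometric_sums[of "1/3::real"], of "(1/3) ^ Suc n"] by (simp add: power_add mult.commute)
    have b: "\<bar>a (k + Suc n)\<bar> \<le> (1/3) ^ (k + Suc n)" for k unfolding a_def by (auto simp: abs_mult)
    have sb: "summable (\<lambda>k. \<bar>a (k + Suc n)\<bar>)"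
      by (rule summable_comparison_test'[OF sums_summable[OF sg]]) (use b in auto)
    have "\<bar>\<Sum>k. a (k + Suc n)\<bar> \<le> (\<Sum>k. \<bar>a (k + Suc n)\<bar>)" by (rule summable_rabs[OF sb])
    also have "\<dots> \<le> (\<Sum>k. (1/3) ^ (k + Suc n))" by (intro suminf_le b sb sums_summable[OF sg])
    also have "\<dots> = (1/3) ^ n / 2" by (rule sums_unique[OF sg, symmetric])
    finally show ?thesis .
  qed
  moreover have "(0::real) < (1/3) ^ n" by simp
  ultimately show False by linarith
qed

text \<open>Codes a point by the basic sets containing it. The resulting order lets every finite
  component choose a least point in a Borel way.\<close>

lemma ex_injective_borel_real:
  obtains h :: "'a::{second_countable_topology, t1_space} \<Rightarrow> real" where "h \<in> borel_measurable borel" "inj h"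
proof -
  obtain U :: "nat \<Rightarrow> 'a set" where U: "\<And>n. open (U n)" "\<And>x V. open V \<Longrightarrow> x \<in> V \<Longrightarrow> \<exists>n. x \<in> U n \<and> U n \<subseteq> V"
    by (rule basis_sequence, rule that, assumption, assumption)
  define h where "h x = (\<Sum>k. of_bool (x \<in> U k) * (1/3::real) ^ k)" for x
  have "(\<lambda>x. of_bool (x \<in> U k) * (1/3::real) ^ k) \<in> borel_measurable borel" for k
  proof -
    have "(\<lambda>x. indicator (U k) x * (1/3::real) ^ k) \<in> borel_measurable borel" using U(1) by auto
    then show ?thesis by (simp add: indicator_def of_bool_def)
  qed
  then have "h \<in> borel_measurable borel" unfolding h_def by (rule borel_measurable_suminf)
  moreover have "inj h"
  proof (rule injI, rule ccontr)
    fix x y assume "h x = h y" "x \<noteq> y"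
    then obtain V where V: "open V" "x \<in> V" "y \<notin> V" using t1_space by blast
    then obtain n where "x \<in> U n" "U n \<subseteq> V" using U(2) by blast
    moreover have "(\<lambda>k. x \<in> U k) = (\<lambda>k. y \<in> U k)" by (rule ternary_sum_inj) (use \<open>h x = h y\<close> in \<open>simp add: h_def\<close>)
    ultimately show False using V by (metis subsetD)
  qed
  ultimately show ?thesis by (rule that)
qed

section \<open>Mass transport along the edges\<close>

context structured_graph
begin

lemma borel_measurable_M: "borel_measurable M = borel_measurable borel"
  by (rule measurable_cong_sets[OF sets_M refl])

lemma nbhd_bij: "x \<in> X0 \<Longrightarrow> bij_betw (\<lambda>i. \<phi> i x) {i. x \<in> D i} (nbhd E x)"
  unfolding bij_betw_def inj_on_def nbhd_def using E_iff D_unique by (auto simp: image_iff)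

lemma nbhd_sum_eq_suminf:
  fixes u :: "'a \<Rightarrow> 'b::{t2_space, comm_monoid_add}"
  assumes "x \<in> X0"
  shows "(\<Sum>y\<in>nbhd E x. u y) = (\<Sum>i. if x \<in> D i then u (\<phi> i x) else 0)"
proof -
  have fin: "finite {i. x \<in> D i}"
    using bij_betw_finite[OF nbhd_bij[OF assms]] X0_deg[OF assms] by simp
  have "(\<Sum>i. if x \<in> D i then u (\<phi> i x) else 0) = (\<Sum>i\<in>{i. x \<in> D i}. if x \<in> D i then u (\<phi> i x) else 0)"
    by (rule suminf_finite[OF fin]) auto
  also have "\<dots> = (\<Sum>i\<in>{i. x \<in> D i}. u (\<phi> i x))" by (intro sum.cong) auto
  also have "\<dots> = (\<Sum>y\<in>nbhd E x. u y)" by (rule sum.reindex_bij_betw[OF nbhd_bij[OF assms]])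
  finally show ?thesis ..
qed

text \<open>Zero off \<open>X0\<close>, where neighbourhoods are uncontrolled, so that neighbour
  sums of Borel functions are Borel everywhere. The type is general because both real functions and
  \<open>ennreal\<close> weights are summed.\<close>

definition nsum :: "('a \<Rightarrow> 'b::comm_monoid_add) \<Rightarrow> 'a \<Rightarrow> 'b" where
  "nsum u x = (if x \<in> X0 then \<Sum>y\<in>nbhd E x. u y else 0)"

lemma nsum_eq_suminf:
  fixes u :: "'a \<Rightarrow> 'b::{t2_space, comm_monoid_add}"
  shows "nsum u x = (\<Sum>i. if x \<in> D i then u (\<phi> i x) else 0)"
proof (cases "x \<in> X0")
  case True then show ?thesis unfolding nsum_def using nbhd_sum_eq_suminf[OF True, of u] by simp
next
  case False
  then have "x \<notin> D i" for i using D_X0 by auto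
  then show ?thesis unfolding nsum_def using False by simp
qed

lemma nsum_measurable:
  fixes u :: "'a \<Rightarrow> real"
  assumes u: "u \<in> borel_measurable borel"
  shows "nsum u \<in> borel_measurable borel"
proof -
  have "(\<lambda>x. if x \<in> D i then u (\<phi> i x) else 0) \<in> borel_measurable borel" for i
    using D_borel by (intro measurable_If measurable_compose[OF \<phi>_borel u]) auto
  then have "(\<lambda>x. \<Sum>i. if x \<in> D i then u (\<phi> i x) else 0) \<in> borel_measurable borel"
    by (rule borel_measurable_suminf)
  then show ?thesis unfolding nsum_eq_suminf[abs_def] .
qed

lemma nn_integral_transport:
  assumes w: "w \<in> borel_measurable borel"
  shows "(\<integral>\<^sup>+x. (if x \<in> D i then w (\<phi> i x) else 0) \<partial>M) = (\<integral>\<^sup>+y. (if y \<in> \<phi> i ` D i then w y else 0) \<partial>M)"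
proof -
  have im: "\<phi> i ` D i \<in> sets M" using \<phi>_image[OF D_borel, of i] sets_M by auto
  have Di: "D i \<in> sets M" using D_borel sets_M by auto
  have \<phi>M: "\<phi> i \<in> measurable M borel" using \<phi>_borel borel_measurable_M by auto
  have eq: "distr (density M (indicator (D i))) borel (\<phi> i) = density M (indicator (\<phi> i ` D i))"
  proof (rule measure_eqI)
    show "sets (distr (density M (indicator (D i))) borel (\<phi> i)) = sets (density M (indicator (\<phi> i ` D i)))"
      using sets_M by simp
    fix B assume "B \<in> sets (distr (density M (indicator (D i))) borel (\<phi> i))"
    then have B: "B \<in> sets borel" by simp
    have pre: "\<phi> i -` B \<in> sets borel" using measurable_sets[OF \<phi>_borel B] by simp
    have "emeasure (distr (density M (indicator (D i))) borel (\<phi> i)) B = emeasure M (D i \<inter> \<phi> i -` B)"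
      using \<phi>M B Di pre sets_M by (simp add: emeasure_distr emeasure_restricted space_M)
    also have "\<dots> = emeasure M (\<phi> i ` (D i \<inter> \<phi> i -` B))"
      using \<phi>_image[of "D i \<inter> \<phi> i -` B" i] D_borel pre by auto
    also have "\<phi> i ` (D i \<inter> \<phi> i -` B) = \<phi> i ` D i \<inter> B" by auto
    also have "emeasure M \<dots> = emeasure (density M (indicator (\<phi> i ` D i))) B"
      using B im sets_M by (simp add: emeasure_restricted)
    finally show "emeasure (distr (density M (indicator (D i))) borel (\<phi> i)) B = emeasure (density M (indicator (\<phi> i ` D i))) B" .
  qed
  have wM: "w \<in> borel_measurable M" "(\<lambda>x. w (\<phi> i x)) \<in> borel_measurable M"
    using w measurable_compose[OF \<phi>_borel w] borel_measurable_M by auto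
  have "(\<integral>\<^sup>+x. (if x \<in> D i then w (\<phi> i x) else 0) \<partial>M) = (\<integral>\<^sup>+x. indicator (D i) x * w (\<phi> i x) \<partial>M)"
    by (intro nn_integral_cong) auto
  also have "\<dots> = (\<integral>\<^sup>+x. w (\<phi> i x) \<partial>density M (indicator (D i)))"
    using wM Di by (intro nn_integral_density[symmetric]) auto
  also have "\<dots> = (\<integral>\<^sup>+y. w y \<partial>distr (density M (indicator (D i))) borel (\<phi> i))"
    using w \<phi>M by (intro nn_integral_distr[symmetric]) auto
  also have "\<dots> = (\<integral>\<^sup>+y. indicator (\<phi> i ` D i) y * w y \<partial>M)"
    unfolding eq using wM im by (intro nn_integral_density) auto
  also have "\<dots> = (\<integral>\<^sup>+y. (if y \<in> \<phi> i ` D i then w y else 0) \<partial>M)"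
    by (intro nn_integral_cong) auto
  finally show ?thesis .
qed

text \<open>Arcs entering \<open>y\<close> are determined by their sources, which by symmetry are
  the neighbours of \<open>y\<close>. So in-degrees on \<open>X0\<close> are \<open>d\<close> as
  well, and transport sends each value \<open>w y\<close> out exactly \<open>d\<close>
  times.\<close>

lemma incoming_bij:
  assumes y: "y \<in> X0"
  shows "bij_betw (\<lambda>i. inv_into (D i) (\<phi> i) y) {i. y \<in> \<phi> i ` D i} (nbhd E y)"
proof (rule bij_betwI')
  fix i j assume i: "i \<in> {i. y \<in> \<phi> i ` D i}" and j: "j \<in> {i. y \<in> \<phi> i ` D i}"
  have "inv_into (D i) (\<phi> i) y \<in> D i" "\<phi> i (inv_into (D i) (\<phi> i) y) = y"
    "inv_into (D j) (\<phi> j) y \<in> D j" "\<phi> j (inv_into (D j) (\<phi> j) y) = y"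
    using i j by (auto intro: inv_into_into f_inv_into_f)
  then show "inv_into (D i) (\<phi> i) y = inv_into (D j) (\<phi> j) y \<longleftrightarrow> i = j" using D_unique by metis
next
  fix i assume "i \<in> {i. y \<in> \<phi> i ` D i}"
  then have "inv_into (D i) (\<phi> i) y \<in> D i" "\<phi> i (inv_into (D i) (\<phi> i) y) = y"
    by (auto intro: inv_into_into f_inv_into_f)
  then have "E (inv_into (D i) (\<phi> i) y) y" using E_iff D_X0 by blast
  then show "inv_into (D i) (\<phi> i) y \<in> nbhd E y" unfolding nbhd_def using sym_E by simp
next
  fix x assume "x \<in> nbhd E y"
  then have "E y x" unfolding nbhd_def by simp
  then have "x \<in> X0" "E x y" using X0_closed[OF y] sym_E by auto
  then obtain i where i: "x \<in> D i" "\<phi> i x = y" using E_iff by blast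
  then have "inv_into (D i) (\<phi> i) y = x" using inv_into_f_f[OF \<phi>_inj i(1)] by simp
  with i show "\<exists>i\<in>{i. y \<in> \<phi> i ` D i}. x = inv_into (D i) (\<phi> i) y" by auto
qed

lemma AE_X0: "AE x in M. x \<in> X0"
  using AE_not_in[OF X0_conull] by simp

lemma nn_integral_nsum:
  fixes w :: "'a \<Rightarrow> ennreal"
  assumes w: "w \<in> borel_measurable borel"
  shows "(\<integral>\<^sup>+x. nsum w x \<partial>M) = of_nat d * (\<integral>\<^sup>+x. w x \<partial>M)"
proof -
  have wM: "w \<in> borel_measurable M" using w borel_measurable_M by auto
  have im: "\<phi> i ` D i \<in> sets M" for i using \<phi>_image[OF D_borel, of i] sets_M by auto
  have "(\<integral>\<^sup>+x. nsum w x \<partial>M) = (\<integral>\<^sup>+x. (\<Sum>i. if x \<in> D i then w (\<phi> i x) else 0) \<partial>M)"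
    by (simp only: nsum_eq_suminf)
  also have "\<dots> = (\<Sum>i. \<integral>\<^sup>+x. (if x \<in> D i then w (\<phi> i x) else 0) \<partial>M)"
    using D_borel measurable_compose[OF \<phi>_borel w]
    by (intro nn_integral_suminf) (auto simp: borel_measurable_M intro!: measurable_If)
  also have "\<dots> = (\<Sum>i. \<integral>\<^sup>+y. (if y \<in> \<phi> i ` D i then w y else 0) \<partial>M)"
    by (simp only: nn_integral_transport[OF w])
  also have "\<dots> = (\<integral>\<^sup>+y. (\<Sum>i. if y \<in> \<phi> i ` D i then w y else 0) \<partial>M)"
    using wM im by (intro nn_integral_suminf[symmetric] measurable_If) auto
  also have "\<dots> = (\<integral>\<^sup>+y. of_nat d * w y \<partial>M)"
  proof (rule nn_integral_cong_AE, rule AE_mp[OF AE_X0], intro AE_I2 impI)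
    fix y assume y: "y \<in> X0"
    have fin: "finite {i. y \<in> \<phi> i ` D i}" and card: "card {i. y \<in> \<phi> i ` D i} = d"
      using bij_betw_finite[OF incoming_bij[OF y]] bij_betw_same_card[OF incoming_bij[OF y]] X0_deg[OF y] by auto
    have "(\<Sum>i. if y \<in> \<phi> i ` D i then w y else 0) = (\<Sum>i\<in>{i. y \<in> \<phi> i ` D i}. if y \<in> \<phi> i ` D i then w y else 0)"
      by (rule suminf_finite[OF fin]) auto
    also have "\<dots> = (\<Sum>i\<in>{i. y \<in> \<phi> i ` D i}. w y)" by (intro sum.cong) auto
    also have "\<dots> = of_nat d * w y" using card by simp
    finally show "(\<Sum>i. if y \<in> \<phi> i ` D i then w y else 0) = of_nat d * w y" .
  qed
  also have "\<dots> = of_nat d * (\<integral>\<^sup>+x. w x \<partial>M)" using wM by (rule nn_integral_cmult)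
  finally show ?thesis .
qed

lemma integral_nsum:
  fixes u :: "'a \<Rightarrow> real"
  assumes u: "u \<in> borel_measurable borel" and nn: "\<And>x. 0 \<le> u x" and int: "integrable M u"
  shows "has_bochner_integral M (nsum u) (d * (\<integral>x. u x \<partial>M))"
proof (rule has_bochner_integral_nn_integral)
  show "nsum u \<in> borel_measurable M" using nsum_measurable[OF u] by (simp add: borel_measurable_M)
  show "AE x in M. 0 \<le> nsum u x" unfolding nsum_def by (auto intro!: sum_nonneg nn)
  show "0 \<le> d * (\<integral>x. u x \<partial>M)" by (intro mult_nonneg_nonneg integral_nonneg_AE) (auto simp: nn)
  have "ennreal (nsum u x) = nsum (\<lambda>x. ennreal (u x)) x" for x unfolding nsum_def by (simp add: sum_ennreal nn)
  then have "(\<integral>\<^sup>+x. ennreal (nsum u x) \<partial>M) = of_nat d * (\<integral>\<^sup>+x. ennreal (u x) \<partial>M)"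
    using u by (simp add: nn_integral_nsum)
  also have "\<dots> = ennreal (d * (\<integral>x. u x \<partial>M))"
    by (subst nn_integral_eq_integral[OF int]) (auto simp: nn ennreal_mult' ennreal_of_nat_eq_real_of_nat)
  finally show "(\<integral>\<^sup>+x. ennreal (nsum u x) \<partial>M) = ennreal (d * (\<integral>x. u x \<partial>M))" .
qed

section \<open>Dirichlet energy and its spectral bounds\<close>

definition energy_density :: "('a \<Rightarrow> real) \<Rightarrow> 'a \<Rightarrow> real" where
  "energy_density u x = (if x \<in> X0 then \<Sum>y\<in>nbhd E x. (u x - u y)\<^sup>2 else 0)"

text \<open>Halved because every edge is seen from both ends.\<close>

definition energy :: "('a \<Rightarrow> real) \<Rightarrow> real" where
  "energy u = (\<integral>x. energy_density u x \<partial>M) / 2"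

lemma energy_cong:
  assumes "\<And>x y. x \<in> X0 \<Longrightarrow> y \<in> X0 \<Longrightarrow> E x y \<Longrightarrow> (u x - u y)\<^sup>2 = (v x - v y)\<^sup>2"
  shows "energy u = energy v"
proof -
  have "energy_density u = energy_density v"
    unfolding energy_density_def nbhd_def using assms X0_closed by (auto intro!: sum.cong)
  then show ?thesis unfolding energy_def by simp
qed

text \<open>Expanding \<open>(u x - u y)\<^sup>2\<close> and transporting the terms
  \<open>(u y)\<^sup>2\<close> yields the quadratic form of the Laplacian; the mixed term is
  integrable because it is dominated by the squares. The upper bound comes from
  \<open>(u x + u y)\<^sup>2 \<ge> 0\<close> in the same way.\<close>

lemma energy_facts:
  assumes u: "u \<in> borel_measurable borel" and int: "integrable M (\<lambda>x. (u x)\<^sup>2)"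
  shows "has_bochner_integral M (\<lambda>x. indicator X0 x * (real d * (u x)\<^sup>2 - u x * nsum u x)) (energy u)" (is ?A)
    and "0 \<le> energy u" and "energy u \<le> 2 * d * (\<integral>x. (u x)\<^sup>2 \<partial>M)"
proof -
  have Su: "nsum u \<in> borel_measurable M" "u \<in> borel_measurable M"
    using nsum_measurable[OF u] u borel_measurable_M by auto
  have iS: "integrable M (nsum (\<lambda>x. (u x)\<^sup>2))" "(\<integral>x. nsum (\<lambda>x. (u x)\<^sup>2) x \<partial>M) = d * (\<integral>x. (u x)\<^sup>2 \<partial>M)"
    using integral_nsum[of "\<lambda>x. (u x)\<^sup>2"] u int by (auto simp: has_bochner_integral_iff)
  have i0: "integrable M (\<lambda>x. indicator X0 x * (d * (u x)\<^sup>2))"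
    using integrable_mult_indicator[of X0 M "\<lambda>x. d * (u x)\<^sup>2"] X0_borel sets_M int by simp
  have bound: "\<bar>u x * nsum u x\<bar> \<le> d * (u x)\<^sup>2 + nsum (\<lambda>x. (u x)\<^sup>2) x" for x
  proof (cases "x \<in> X0")
    case True
    have "\<bar>u x * nsum u x\<bar> = \<bar>\<Sum>y\<in>nbhd E x. u x * u y\<bar>" using True unfolding nsum_def by (simp add: sum_distrib_left)
    also have "\<dots> \<le> (\<Sum>y\<in>nbhd E x. (u x)\<^sup>2 + (u y)\<^sup>2)"
    proof (rule order_trans[OF sum_abs], rule sum_mono)
      fix y
      have "0 \<le> (\<bar>u x\<bar> - \<bar>u y\<bar>)\<^sup>2" by simp
      then show "\<bar>u x * u y\<bar> \<le> (u x)\<^sup>2 + (u y)\<^sup>2"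
        using abs_ge_zero[of "u x * u y"] unfolding power2_diff abs_mult power2_abs by linarith
    qed
    also have "\<dots> = d * (u x)\<^sup>2 + nsum (\<lambda>x. (u x)\<^sup>2) x"
      using True X0_deg[OF True] unfolding nsum_def by (simp add: sum.distrib)
    finally show ?thesis .
  qed (simp add: nsum_def)
  have i1: "integrable M (\<lambda>x. u x * nsum u x)"
  proof (rule Bochner_Integration.integrable_bound)
    show "integrable M (\<lambda>x. d * (u x)\<^sup>2 + nsum (\<lambda>x. (u x)\<^sup>2) x)" using int iS by auto
    show "AE x in M. norm (u x * nsum u x) \<le> norm (d * (u x)\<^sup>2 + nsum (\<lambda>x. (u x)\<^sup>2) x)"
      using bound by (auto intro!: order_trans[OF _ abs_ge_self])
  qed (use Su in measurable)
  have I0: "(\<integral>x. indicator X0 x * (d * (u x)\<^sup>2) \<partial>M) = d * (\<integral>x. (u x)\<^sup>2 \<partial>M)"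
  proof -
    have "(\<integral>x. indicator X0 x * (d * (u x)\<^sup>2) \<partial>M) = (\<integral>x. d * (u x)\<^sup>2 \<partial>M)"
    proof (rule integral_cong_AE)
      show "AE x in M. indicator X0 x * (d * (u x)\<^sup>2) = d * (u x)\<^sup>2" using AE_X0 by eventually_elim simp
    qed (use i0 int in \<open>auto intro: borel_measurable_integrable\<close>)
    then show ?thesis by simp
  qed
  have eq: "energy_density u x = indicator X0 x * (d * (u x)\<^sup>2) - 2 * (u x * nsum u x) + nsum (\<lambda>x. (u x)\<^sup>2) x" for x
  proof (cases "x \<in> X0")
    case True
    have "(\<Sum>y\<in>nbhd E x. (u x - u y)\<^sup>2) = (\<Sum>y\<in>nbhd E x. (u x)\<^sup>2 - 2 * (u x * u y) + (u y)\<^sup>2)"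
      by (intro sum.cong) (auto simp: power2_diff)
    then show ?thesis using True X0_deg[OF True] unfolding energy_density_def nsum_def
      by (simp add: sum.distrib sum_subtractf sum_distrib_left)
  qed (simp add: energy_density_def nsum_def)
  have E2: "2 * energy u = 2 * d * (\<integral>x. (u x)\<^sup>2 \<partial>M) - 2 * (\<integral>x. u x * nsum u x \<partial>M)"
    unfolding energy_def eq[abs_def] using i0 i1 iS I0 by simp
  have eq2: "indicator X0 x * (real d * (u x)\<^sup>2 - u x * nsum u x) = indicator X0 x * (d * (u x)\<^sup>2) - u x * nsum u x" for x
    unfolding nsum_def by (simp add: indicator_def)
  show ?A
    unfolding has_bochner_integral_iff eq2 using i0 i1 I0 E2 by simp
  have "0 \<le> (\<integral>x. energy_density u x \<partial>M)"
    by (intro integral_nonneg_AE) (auto simp: energy_density_def intro!: sum_nonneg)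
  then show "0 \<le> energy u" unfolding energy_def by simp
  have "- (\<integral>x. u x * nsum u x \<partial>M) = (\<integral>x. - (u x * nsum u x) \<partial>M)" by simp
  also have "\<dots> \<le> (\<integral>x. (d * (u x)\<^sup>2 + nsum (\<lambda>x. (u x)\<^sup>2) x) / 2 \<partial>M)"
  proof (rule integral_mono)
    show "integrable M (\<lambda>x. - (u x * nsum u x))" using i1 by simp
    show "integrable M (\<lambda>x. (d * (u x)\<^sup>2 + nsum (\<lambda>x. (u x)\<^sup>2) x) / 2)" using int iS by auto
    fix x
    show "- (u x * nsum u x) \<le> (d * (u x)\<^sup>2 + nsum (\<lambda>x. (u x)\<^sup>2) x) / 2"
    proof (cases "x \<in> X0")
      case True
      have "0 \<le> (\<Sum>y\<in>nbhd E x. (u x + u y)\<^sup>2)" by (intro sum_nonneg) simp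
      also have "\<dots> = (\<Sum>y\<in>nbhd E x. (u x)\<^sup>2 + 2 * (u x * u y) + (u y)\<^sup>2)"
        by (intro sum.cong) (auto simp: power2_sum)
      also have "\<dots> = d * (u x)\<^sup>2 + 2 * (u x * nsum u x) + nsum (\<lambda>x. (u x)\<^sup>2) x"
        using True X0_deg[OF True] unfolding nsum_def by (simp add: sum.distrib sum_distrib_left)
      finally show ?thesis by simp
    qed (simp add: nsum_def)
  qed
  also have "\<dots> = d * (\<integral>x. (u x)\<^sup>2 \<partial>M)" using int iS by simp
  finally show "energy u \<le> 2 * d * (\<integral>x. (u x)\<^sup>2 \<partial>M)" using E2 by simp
qed

text \<open>The Rayleigh quotient of \<open>f\<close> is \<open>0\<close> when \<open>laplacian E f x * f x\<close> is not Borel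
  measurable, which null sets outside \<open>X0\<close> can cause.\<close>

lemma rayleigh_bounded: "rayleigh_quotients M E \<subseteq> {0..2 * real d}"
proof
  fix r assume "r \<in> rayleigh_quotients M E"
  then obtain f where f: "f \<in> borel_measurable borel" "integrable M (\<lambda>x. (f x)\<^sup>2)"
    and r: "r = (\<integral>x. laplacian E f x * f x \<partial>M) / (\<integral>x. (f x)\<^sup>2 \<partial>M)"
    unfolding rayleigh_quotients_def L2_0_nonzero_def using borel_measurable_M by auto
  have nn: "0 \<le> (\<integral>x. (f x)\<^sup>2 \<partial>M)" by simp
  have "0 \<le> (\<integral>x. laplacian E f x * f x \<partial>M) \<and> (\<integral>x. laplacian E f x * f x \<partial>M) \<le> 2 * d * (\<integral>x. (f x)\<^sup>2 \<partial>M)"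
  proof (cases "integrable M (\<lambda>x. laplacian E f x * f x)")
    case True
    have "(\<integral>x. laplacian E f x * f x \<partial>M) = (\<integral>x. indicator X0 x * (real d * (f x)\<^sup>2 - f x * nsum f x) \<partial>M)"
    proof (rule integral_cong_AE)
      show "AE x in M. laplacian E f x * f x = indicator X0 x * (real d * (f x)\<^sup>2 - f x * nsum f x)"
        using AE_X0 by eventually_elim
          (use X0_deg in \<open>auto simp: laplacian_def deg_def nsum_def power2_eq_square algebra_simps\<close>)
    qed (use True energy_facts(1)[OF f] in \<open>auto simp: has_bochner_integral_iff\<close>)
    then show ?thesis using energy_facts[OF f] by (auto simp: has_bochner_integral_iff)
  next
    case False
    then show ?thesis using nn by (simp add: not_integrable_integral_eq)
  qed
  moreover have "(\<integral>x. (f x)\<^sup>2 \<partial>M) = 0 \<or> 0 < (\<integral>x. (f x)\<^sup>2 \<partial>M)" using nn by linarith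
  ultimately show "r \<in> {0..2 * real d}" unfolding r by (auto simp: divide_simps)
qed

lemma rayleigh_energy:
  assumes u: "u \<in> borel_measurable borel" and int: "integrable M (\<lambda>x. (u x)\<^sup>2)" and mean: "(\<integral>x. u x \<partial>M) = 0"
  shows "m_L M E * (\<integral>x. (u x)\<^sup>2 \<partial>M) \<le> energy u \<and> energy u \<le> M_L M E * (\<integral>x. (u x)\<^sup>2 \<partial>M)"
proof (cases "AE x in M. u x = 0")
  case True
  have uM: "u \<in> borel_measurable M" using u by (simp add: borel_measurable_M)
  have "(\<integral>x. (u x)\<^sup>2 \<partial>M) = (\<integral>x. 0 \<partial>M)"
    using True uM by (intro integral_cong_AE) auto
  then have z: "(\<integral>x. (u x)\<^sup>2 \<partial>M) = 0" by simp
  then show ?thesis using energy_facts(2,3)[OF u int] by simp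
next
  case False
  have uM: "u \<in> borel_measurable M" using u by (simp add: borel_measurable_M)
  \<comment> \<open>The cut-off changes neither the norm nor the energy, but makes
    \<open>laplacian E v x * v x\<close> vanish off \<open>X0\<close>, where the Laplacian could
    spoil measurability.\<close>
  define v where "v x = indicator X0 x * u x" for x
  have v: "v \<in> borel_measurable borel" unfolding v_def using u X0_borel by measurable
  then have vM: "v \<in> borel_measurable M" by (simp add: borel_measurable_M)
  have AEv: "AE x in M. v x = u x" using AE_X0 by eventually_elim (simp add: v_def)
  have v2: "(\<integral>x. (v x)\<^sup>2 \<partial>M) = (\<integral>x. (u x)\<^sup>2 \<partial>M)"
    using AEv vM uM by (intro integral_cong_AE) auto
  have vi: "integrable M (\<lambda>x. (v x)\<^sup>2)"
    using int by (subst integrable_cong_AE[where g="\<lambda>x. (u x)\<^sup>2"]) (use AEv vM uM in auto)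
  have v0: "(\<integral>x. v x \<partial>M) = 0"
    using integral_cong_AE[OF vM uM AEv] mean by simp
  have "\<not> (AE x in M. v x = 0)"
  proof
    assume "AE x in M. v x = 0"
    with AEv have "AE x in M. u x = 0" by eventually_elim simp
    with False show False by simp
  qed
  then have "v \<in> L2_0_nonzero M" unfolding L2_0_nonzero_def using vM vi v0 by simp
  moreover have "laplacian E v x * v x = indicator X0 x * (real d * (v x)\<^sup>2 - v x * nsum v x)" for x
    using X0_deg[of x] by (cases "x \<in> X0") (auto simp: laplacian_def deg_def nsum_def power2_eq_square algebra_simps v_def)
  then have "(\<integral>x. laplacian E v x * v x \<partial>M) = energy v"
    using energy_facts(1)[OF v vi] by (simp add: has_bochner_integral_iff)
  moreover have "energy v = energy u" by (rule energy_cong) (simp add: v_def)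
  ultimately have q: "energy u / (\<integral>x. (u x)\<^sup>2 \<partial>M) \<in> rayleigh_quotients M E"
    unfolding rayleigh_quotients_def v2[symmetric] by (metis (no_types, lifting) image_eqI)
  have pos: "0 < (\<integral>x. (u x)\<^sup>2 \<partial>M)"
    using False integral_nonneg_eq_0_iff_AE[OF int] by (auto simp: less_le)
  have "m_L M E \<le> energy u / (\<integral>x. (u x)\<^sup>2 \<partial>M)"
    unfolding m_L_def using rayleigh_bounded by (intro cInf_lower q bdd_belowI[of _ 0]) auto
  moreover have "energy u / (\<integral>x. (u x)\<^sup>2 \<partial>M) \<le> M_L M E"
    unfolding M_L_def using rayleigh_bounded by (intro cSup_upper q bdd_aboveI[of _ "2 * real d"]) auto
  ultimately show ?thesis using pos by (simp add: field_simps)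
qed

text \<open>The energy ignores additive constants, so subtracting the mean extends the bounds to
  bounded functions of any mean, with the variance in place of the squared norm.\<close>

lemma energy_bounds:
  assumes u: "u \<in> borel_measurable borel" and bd: "\<And>x. \<bar>u x\<bar> \<le> b"
  shows "m_L M E * ((\<integral>x. (u x)\<^sup>2 \<partial>M) - (\<integral>x. u x \<partial>M)\<^sup>2) \<le> energy u"
    and "energy u \<le> M_L M E * ((\<integral>x. (u x)\<^sup>2 \<partial>M) - (\<integral>x. u x \<partial>M)\<^sup>2)"
proof -
  define c where "c = (\<integral>x. u x \<partial>M)"
  define v where "v x = u x - c" for x
  have uM: "u \<in> borel_measurable M" using u by (simp add: borel_measurable_M)
  have iu: "integrable M u" by (rule integrable_const_bound[where B = b]) (use bd uM in auto)
  have iu2: "integrable M (\<lambda>x. (u x)\<^sup>2)"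
  proof (rule integrable_const_bound[where B = "b\<^sup>2"])
    show "AE x in M. norm ((u x)\<^sup>2) \<le> b\<^sup>2"
      using bd by (auto simp: abs_le_square_iff[symmetric] intro: order_trans[OF _ abs_ge_self])
  qed (use uM in measurable)
  have v: "v \<in> borel_measurable borel" unfolding v_def using u by measurable
  have v2: "(v x)\<^sup>2 = (u x)\<^sup>2 - 2 * c * u x + c\<^sup>2" for x unfolding v_def by (simp add: power2_diff algebra_simps)
  have iv2: "integrable M (\<lambda>x. (v x)\<^sup>2)" unfolding v2 using iu iu2 by auto
  have "(\<integral>x. v x \<partial>M) = 0" unfolding v_def using iu by (simp add: c_def prob_space)
  moreover have "(\<integral>x. (v x)\<^sup>2 \<partial>M) = (\<integral>x. (u x)\<^sup>2 \<partial>M) - c\<^sup>2"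
    unfolding v2 using iu iu2 by (simp add: prob_space power2_eq_square flip: c_def)
  moreover have "energy v = energy u" by (rule energy_cong) (simp add: v_def)
  ultimately show "m_L M E * ((\<integral>x. (u x)\<^sup>2 \<partial>M) - (\<integral>x. u x \<partial>M)\<^sup>2) \<le> energy u"
    "energy u \<le> M_L M E * ((\<integral>x. (u x)\<^sup>2 \<partial>M) - (\<integral>x. u x \<partial>M)\<^sup>2)"
    using rayleigh_energy[OF v iv2] unfolding c_def by auto
qed

section \<open>Energy of sets and separation\<close>

lemma nbhd_meets_borel:
  assumes "B \<in> sets borel"
  shows "{x \<in> X0. nbhd E x \<inter> B \<noteq> {}} \<in> sets borel"
proof -
  have "{x \<in> X0. nbhd E x \<inter> B \<noteq> {}} = (\<Union>i. D i \<inter> \<phi> i -` B)"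
  proof (intro set_eqI iffI)
    fix x assume "x \<in> {x \<in> X0. nbhd E x \<inter> B \<noteq> {}}"
    then obtain y where "x \<in> X0" "E x y" "y \<in> B" unfolding nbhd_def by auto
    then show "x \<in> (\<Union>i. D i \<inter> \<phi> i -` B)" using E_iff[of x y] by auto
  next
    fix x assume "x \<in> (\<Union>i. D i \<inter> \<phi> i -` B)"
    then obtain i where i: "x \<in> D i" "\<phi> i x \<in> B" by auto
    moreover then have "x \<in> X0" using D_X0 by auto
    moreover then have "E x (\<phi> i x)" using E_iff i by blast
    ultimately show "x \<in> {x \<in> X0. nbhd E x \<inter> B \<noteq> {}}" unfolding nbhd_def by auto
  qed
  moreover have "\<phi> i -` B \<in> sets borel" for i using measurable_sets[OF \<phi>_borel assms] by simp
  ultimately show ?thesis using D_borel by auto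
qed

text \<open>The energy of an indicator measures the edge boundary of the set, each boundary edge
  being counted at its inner end.\<close>

lemma energy_indicator:
  assumes S: "S \<in> sets borel"
  shows "has_bochner_integral M (\<lambda>x. indicator (X0 \<inter> S) x * (real d - real (card (nbhd E x \<inter> S)))) (energy (indicator S))"
proof -
  have u: "(indicator S :: 'a \<Rightarrow> real) \<in> borel_measurable borel" using S by simp
  have int: "integrable M (\<lambda>x. (indicator S x :: real)\<^sup>2)"
    using S sets_M by (intro integrable_const_bound[where B=1]) (auto simp: indicator_def borel_measurable_M intro!: borel_measurable_indicator')
  have "indicator X0 x * (real d * (indicator S x)\<^sup>2 - indicator S x * nsum (indicator S) x)
      = indicator (X0 \<inter> S) x * (real d - real (card (nbhd E x \<inter> S)))" for x
  proof (cases "x \<in> X0 \<inter> S")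
    case True
    then have "nsum (indicator S) x = real (card (nbhd E x \<inter> S))"
      unfolding nsum_def using X0_deg[of x] by (simp add: indicator_def sum.If_cases Int_def)
    with True show ?thesis by simp
  qed (auto simp: indicator_def)
  then show ?thesis using energy_facts(1)[OF u int] by simp
qed

lemma indicator_variance:
  assumes "S \<in> sets borel"
  shows "m_L M E * (measure M S - (measure M S)\<^sup>2) \<le> energy (indicator S)"
    and "energy (indicator S) \<le> M_L M E * (measure M S - (measure M S)\<^sup>2)"
proof -
  have "(indicator S x :: real)\<^sup>2 = indicator S x" for x by (simp add: indicator_def)
  moreover have "(\<integral>x. indicator S x \<partial>M) = measure M S" using assms sets_M by simp
  ultimately show "m_L M E * (measure M S - (measure M S)\<^sup>2) \<le> energy (indicator S)"
    "energy (indicator S) \<le> M_L M E * (measure M S - (measure M S)\<^sup>2)"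
    using energy_bounds[of "indicator S" 1] assms by (auto simp: indicator_def)
qed

lemma measure_X0_Int: "S \<in> sets borel \<Longrightarrow> measure M (X0 \<inter> S) = measure M S"
  using AE_X0 X0_borel sets_M by (intro finite_measure_eq_AE) auto

text \<open>Hoffman's ratio bound: all \<open>d\<close> edges at a vertex of \<open>S\<close> leave
  \<open>S\<close>, so the boundary is as large as it can be.\<close>

lemma independent_bound:
  assumes S: "S \<in> sets borel" and indep: "\<And>x y. x \<in> S \<Longrightarrow> y \<in> S \<Longrightarrow> x \<in> X0 \<Longrightarrow> \<not> E x y"
  shows "d * measure M S \<le> M_L M E * (measure M S - (measure M S)\<^sup>2)"
proof -
  have "energy (indicator S) = (\<integral>x. indicator (X0 \<inter> S) x * (real d - real (card (nbhd E x \<inter> S))) \<partial>M)"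
    using energy_indicator[OF S] by (simp add: has_bochner_integral_iff)
  also have "\<dots> = (\<integral>x. indicator (X0 \<inter> S) x * real d \<partial>M)"
  proof (intro Bochner_Integration.integral_cong refl)
    fix x
    have "nbhd E x \<inter> S = {}" if "x \<in> X0 \<inter> S" using that indep unfolding nbhd_def by auto
    then show "indicator (X0 \<inter> S) x * (real d - real (card (nbhd E x \<inter> S))) = indicator (X0 \<inter> S) x * real d"
      by (cases "x \<in> X0 \<inter> S") auto
  qed
  also have "\<dots> = d * measure M S" using S X0_borel sets_M by (simp add: measure_X0_Int)
  finally show ?thesis using indicator_variance(2)[OF S] by simp
qed

text \<open>At least one edge at each vertex stays inside \<open>S\<close>, so at most
  \<open>d - 1\<close> of them leave.\<close>

lemma no_isolated_bound:
  assumes S: "S \<in> sets borel" and nbr: "\<And>x. x \<in> S \<Longrightarrow> x \<in> X0 \<Longrightarrow> \<exists>y\<in>S. E x y"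
  shows "m_L M E * (measure M S - (measure M S)\<^sup>2) \<le> (real d - 1) * measure M S"
proof -
  have "energy (indicator S) = (\<integral>x. indicator (X0 \<inter> S) x * (real d - real (card (nbhd E x \<inter> S))) \<partial>M)"
    using energy_indicator[OF S] by (simp add: has_bochner_integral_iff)
  also have "\<dots> \<le> (\<integral>x. indicator (X0 \<inter> S) x * (real d - 1) \<partial>M)"
  proof (rule integral_mono)
    show "integrable M (\<lambda>x. indicator (X0 \<inter> S) x * (real d - real (card (nbhd E x \<inter> S))))"
      using energy_indicator[OF S] by (simp add: has_bochner_integral_iff)
    show "integrable M (\<lambda>x. indicator (X0 \<inter> S) x * (real d - 1))"
      using S X0_borel sets_M by (intro integrable_mult_left integrable_real_indicator) (auto simp: less_top[symmetric])
    fix x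
    have "1 \<le> card (nbhd E x \<inter> S)" if x: "x \<in> X0 \<inter> S"
    proof -
      have "nbhd E x \<inter> S \<noteq> {}" using nbr x unfolding nbhd_def by auto
      moreover have "finite (nbhd E x \<inter> S)" using X0_deg x by auto
      ultimately show ?thesis by (simp add: Suc_le_eq card_gt_0_iff)
    qed
    then show "indicator (X0 \<inter> S) x * (real d - real (card (nbhd E x \<inter> S))) \<le> indicator (X0 \<inter> S) x * (real d - 1)"
      by (cases "x \<in> X0 \<inter> S") auto
  qed
  also have "\<dots> = (real d - 1) * measure M S" using S X0_borel sets_M by (simp add: measure_X0_Int)
  finally show ?thesis using indicator_variance(1)[OF S] by linarith
qed

text \<open>Without edges between \<open>B\<close> and \<open>C\<close>, the functions \<open>s 1\<^sub>B - t 1\<^sub>C\<close> and \<open>s 1\<^sub>B + t 1\<^sub>C\<close> have the same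
  energy but different variances; this gives \<open>9 b c \<le> (1 - b) (1 - c)\<close> for the measures \<open>b\<close> and \<open>c\<close>.\<close>

lemma separation_bound:
  assumes BC: "B \<in> sets borel" "C \<in> sets borel" "B \<inter> C = {}"
    and sep: "\<And>x y. x \<in> X0 \<Longrightarrow> x \<in> B \<Longrightarrow> y \<in> C \<Longrightarrow> \<not> E x y"
    and m: "0 < m_L M E" and mM: "M_L M E \<le> 2 * m_L M E"
  shows "8 * measure M B * measure M C \<le> 1 - measure M B - measure M C"
proof -
  define b where "b = measure M B"
  define c where "c = measure M C"
  have BM: "B \<in> sets M" "C \<in> sets M" using BC sets_M by auto
  have bc: "0 \<le> b" "0 \<le> c" "b + c \<le> 1"
  proof -
    have "b + c = measure M (B \<union> C)" unfolding b_def c_def using BM BC(3) by (simp add: finite_measure_Union)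
    then show "b + c \<le> 1" by simp
  qed (auto simp: b_def c_def)
  \<comment> \<open>The lower bound for the difference is played against the upper bound for the
    sum. In \<open>2 (s b + t c)\<^sup>2 - (s b - t c)\<^sup>2\<close> the squares survive once and
    the cross terms add up to 4 + 2 = 6.\<close>
  have key: "6 * s * t * b * c \<le> s\<^sup>2 * (b * (1 - b)) + t\<^sup>2 * (c * (1 - c))" if st: "0 \<le> s" "0 \<le> t" for s t :: real
  proof -
    define u where "u r x = s * indicator B x + r * t * indicator C x" for r :: real and x
    have um: "u r \<in> borel_measurable borel" for r unfolding u_def using BC by simp
    have ib: "\<bar>u r x\<bar> \<le> s + t" if "\<bar>r\<bar> = 1" for r x
      using st that BC(3) unfolding u_def by (auto simp: indicator_def abs_mult)
    have I1: "(\<integral>x. u r x \<partial>M) = s * b + r * t * c" for r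
      unfolding u_def b_def c_def using BM by (subst Bochner_Integration.integral_add) (auto simp: less_top[symmetric])
    have sq: "(u r x)\<^sup>2 = s\<^sup>2 * indicator B x + r\<^sup>2 * t\<^sup>2 * indicator C x" for r x
      using BC(3) unfolding u_def by (auto simp: indicator_def power_mult_distrib)
    have I2: "(\<integral>x. (u r x)\<^sup>2 \<partial>M) = s\<^sup>2 * b + r\<^sup>2 * t\<^sup>2 * c" for r
      unfolding sq b_def c_def using BM by (subst Bochner_Integration.integral_add) (auto simp: less_top[symmetric])
    have "energy (u (-1)) = energy (u 1)"
    proof (rule energy_cong)
      fix x y assume "x \<in> X0" "y \<in> X0" "E x y"
      then have "\<not> (x \<in> B \<and> y \<in> C)" "\<not> (y \<in> B \<and> x \<in> C)" using sep sym_E by blast+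
      then show "(u (-1) x - u (-1) y)\<^sup>2 = (u 1 x - u 1 y)\<^sup>2"
        unfolding u_def using BC(3) by (auto simp: indicator_def power2_commute)
    qed
    moreover have "m_L M E * (s\<^sup>2 * b + t\<^sup>2 * c - (s * b - t * c)\<^sup>2) \<le> energy (u (-1))"
      using energy_bounds(1)[OF um ib, of "-1"] unfolding I1 I2 by simp
    moreover have "energy (u 1) \<le> M_L M E * (s\<^sup>2 * b + t\<^sup>2 * c - (s * b + t * c)\<^sup>2)"
      using energy_bounds(2)[OF um ib, of 1] unfolding I1 I2 by simp
    moreover have "M_L M E * (s\<^sup>2 * b + t\<^sup>2 * c - (s * b + t * c)\<^sup>2) \<le> 2 * m_L M E * (s\<^sup>2 * b + t\<^sup>2 * c - (s * b + t * c)\<^sup>2)"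
    proof (rule mult_right_mono[OF mM])
      have "0 \<le> b * (1 - b) * s\<^sup>2 + c * (1 - c) * t\<^sup>2 - 2 * (s * t) * (b * c)"
      proof -
        have "0 \<le> b * c * (s - t)\<^sup>2" using bc by simp
        moreover have "b * c * s\<^sup>2 \<le> b * (1 - b) * s\<^sup>2" "c * b * t\<^sup>2 \<le> c * (1 - c) * t\<^sup>2"
          using bc by (intro mult_right_mono mult_left_mono; simp)+
        ultimately show ?thesis by (simp add: power2_diff algebra_simps)
      qed
      then show "0 \<le> s\<^sup>2 * b + t\<^sup>2 * c - (s * b + t * c)\<^sup>2"
        by (simp add: power2_eq_square algebra_simps)
    qed
    ultimately have "m_L M E * (s\<^sup>2 * b + t\<^sup>2 * c - (s * b - t * c)\<^sup>2) \<le> m_L M E * (2 * (s\<^sup>2 * b + t\<^sup>2 * c - (s * b + t * c)\<^sup>2))"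
      by (simp add: mult.assoc mult.left_commute)
    then have "s\<^sup>2 * b + t\<^sup>2 * c - (s * b - t * c)\<^sup>2 \<le> 2 * (s\<^sup>2 * b + t\<^sup>2 * c - (s * b + t * c)\<^sup>2)"
      using m by simp
    then show ?thesis by (simp add: power2_eq_square algebra_simps)
  qed
  have "8 * b * c \<le> 1 - b - c"
  proof (cases "b = 0 \<or> c = 0")
    case True then show ?thesis using bc by auto
  next
    case False
    then have pos: "0 < b" "0 < c" "b < 1" "c < 1" using bc by auto
    \<comment> \<open>The choice \<open>s\<^sup>2 = G\<close>, \<open>t\<^sup>2 = F\<close> makes
      the two terms on the right of \<open>key\<close> equal, which is optimal.\<close>
    define F where "F = b * (1 - b)"
    define G where "G = c * (1 - c)"
    have FG: "0 < F" "0 < G" using pos unfolding F_def G_def by auto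
    have "6 * sqrt G * sqrt F * b * c \<le> G * F + F * G"
      using key[of "sqrt G" "sqrt F"] FG unfolding F_def[symmetric] G_def[symmetric] by simp
    also have "\<dots> = 2 * (sqrt G * sqrt F) * (sqrt G * sqrt F)" using FG by (simp add: power2_eq_square[symmetric] power_mult_distrib mult.assoc)
    finally have "2 * (sqrt G * sqrt F) * (3 * b * c) \<le> 2 * (sqrt G * sqrt F) * (sqrt G * sqrt F)" by (simp add: algebra_simps)
    moreover have "0 < 2 * (sqrt G * sqrt F)" using FG by simp
    ultimately have "3 * b * c \<le> sqrt G * sqrt F" by (rule mult_left_le_imp_le)
    then have "(3 * b * c)\<^sup>2 \<le> (sqrt G * sqrt F)\<^sup>2" using pos by (intro power_mono) auto
    also have "\<dots> = G * F" using FG by (simp add: power_mult_distrib)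
    finally have "(b * c) * (9 * b * c) \<le> (b * c) * ((1 - b) * (1 - c))"
      unfolding F_def G_def by (simp add: power2_eq_square algebra_simps)
    moreover have "0 < b * c" using pos by simp
    ultimately have "9 * b * c \<le> (1 - b) * (1 - c)" by (rule mult_left_le_imp_le)
    then show ?thesis by (simp add: algebra_simps)
  qed
  then show ?thesis unfolding b_def c_def .
qed

section \<open>Bounds on the spectral gap\<close>

lemma small_open_nbhd:
  assumes atomless: "\<And>x. emeasure M {x} = 0" and e: "0 < e"
  obtains V where "open V" "x \<in> V" "measure M V < e"
proof -
  have "emeasure M {x} = (INF V \<in> {V. {x} \<subseteq> V \<and> open V}. emeasure M V)"
    by (rule outer_regular) (auto simp: sets_M)
  then have "(INF V \<in> {V. {x} \<subseteq> V \<and> open V}. emeasure M V) < ennreal e" using atomless e by simp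
  then obtain V where "x \<in> V" "open V" "emeasure M V < ennreal e" unfolding INF_less_iff by auto
  then show ?thesis using that e by (simp add: emeasure_eq_measure ennreal_less_iff)
qed

lemma cover_pos:
  assumes S: "\<And>n::nat. S n \<in> sets borel" and cov: "X0 \<subseteq> (\<Union>n. S n)"
  obtains n where "0 < measure M (S n)"
proof -
  have "\<exists>n. 0 < measure M (S n)"
  proof (rule ccontr)
    assume "\<not> ?thesis"
    then have "S n \<in> null_sets M" for n
      using S sets_M by (auto simp: null_sets_def emeasure_eq_measure not_less intro: antisym[OF _ measure_nonneg])
    then have "(\<Union>n. S n) \<union> - X0 \<in> null_sets M" using X0_conull by (intro null_sets.Un null_sets_UN)
    moreover have "(\<Union>n. S n) \<union> - X0 = space M" using cov space_M by auto
    ultimately show False using emeasure_space_1 by (auto simp: null_sets_def)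
  qed
  then show ?thesis using that by blast
qed

text \<open>Neighbourhoods being finite, each vertex of \<open>X0\<close> lies in a basic set free
  of its neighbours. For each \<open>n\<close> the vertices of \<open>U n\<close> without neighbours
  in \<open>U n\<close> are independent, and for some \<open>n\<close> they have positive measure.
  Their energy is then positive, hence so is \<open>M_L\<close>, and with it
  \<open>m_L\<close>.\<close>

lemma spectral_gap_pos:
  assumes d: "0 < d" and mM: "M_L M E \<le> 2 * m_L M E"
  shows "0 < m_L M E"
proof -
  obtain U :: "nat \<Rightarrow> 'a set" where U: "\<And>n. open (U n)" "\<And>x V. open V \<Longrightarrow> x \<in> V \<Longrightarrow> \<exists>n. x \<in> U n \<and> U n \<subseteq> V"
    by (rule basis_sequence, rule that, assumption, assumption)
  define S where "S n = (X0 \<inter> U n) - {x \<in> X0. nbhd E x \<inter> U n \<noteq> {}}" for n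
  have Sb: "S n \<in> sets borel" for n unfolding S_def using X0_borel U(1) by (intro sets.Diff nbhd_meets_borel) auto
  have "X0 \<subseteq> (\<Union>n. S n)"
  proof
    fix x assume x: "x \<in> X0"
    have "open (- nbhd E x)" using X0_deg[OF x] by (intro open_Compl finite_imp_closed) auto
    moreover have "x \<in> - nbhd E x" unfolding nbhd_def using irrefl_E by simp
    ultimately obtain n where "x \<in> U n" "U n \<subseteq> - nbhd E x" using U(2) by blast
    then show "x \<in> (\<Union>n. S n)" unfolding S_def using x by auto
  qed
  then obtain n where n: "0 < measure M (S n)" using cover_pos[of S] Sb by blast
  have "d * measure M (S n) \<le> M_L M E * (measure M (S n) - (measure M (S n))\<^sup>2)"
    by (rule independent_bound[OF Sb]) (auto simp: S_def nbhd_def)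
  moreover have "0 < d * measure M (S n)" using d n by simp
  moreover have "0 \<le> measure M (S n) - (measure M (S n))\<^sup>2"
    using mult_left_le[of "measure M (S n)" "measure M (S n)"] by (simp add: power2_eq_square)
  ultimately have "0 < M_L M E" by (smt (verit) mult_nonpos_nonneg)
  then show ?thesis using mM by simp
qed

text \<open>A set of measure \<open>s < 1 / d\<close> in which every vertex has a neighbour gives
  \<open>m_L * (1 - s) \<le> d - 1 < d * (1 - s)\<close>. Such sets grow around single edges: join
  two basic sets of measure below \<open>1 / (2 * d)\<close> containing the ends, and keep the
  vertices with a neighbour in the union.\<close>

lemma spectral_gap_less_degree:
  assumes d: "0 < d" and atomless: "\<And>x. emeasure M {x} = 0"
  shows "m_L M E < d"
proof -
  obtain U :: "nat \<Rightarrow> 'a set" where U: "\<And>n. open (U n)" "\<And>x V. open V \<Longrightarrow> x \<in> V \<Longrightarrow> \<exists>n. x \<in> U n \<and> U n \<subseteq> V"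
    by (rule basis_sequence, rule that, assumption, assumption)
  define e where "e = 1 / (2 * real d)"
  have e: "0 < e" unfolding e_def using d by simp
  define V where "V k = (case prod_decode k of (i, j) \<Rightarrow> if measure M (U i) < e \<and> measure M (U j) < e then U i \<union> U j else {})" for k
  have Vo: "open (V k)" for k unfolding V_def using U(1) by (auto split: prod.split)
  have Vm: "measure M (V k) < 1 / d" for k
  proof (cases "prod_decode k")
    case (Pair i j)
    show ?thesis
    proof (cases "measure M (U i) < e \<and> measure M (U j) < e")
      case True
      have "measure M (V k) \<le> measure M (U i) + measure M (U j)"
        unfolding V_def Pair using True U(1) sets_M by (auto intro!: measure_Un_le)
      also have "\<dots> < 2 * e" using True by simp
      also have "\<dots> = 1 / d" unfolding e_def by simp
      finally show ?thesis .
    next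
      case False
      then have "V k = {}" unfolding V_def Pair by auto
      then show ?thesis using d by simp
    qed
  qed
  have small: "\<exists>i. x \<in> U i \<and> measure M (U i) < e" for x
  proof -
    obtain W where W: "open W" "x \<in> W" "measure M W < e" using small_open_nbhd[OF atomless e] by blast
    then obtain i where i: "x \<in> U i" "U i \<subseteq> W" using U(2) by blast
    have "measure M (U i) \<le> measure M W" using i W(1) sets_M by (intro finite_measure_mono) auto
    then show ?thesis using i W by auto
  qed
  define S where "S k = X0 \<inter> V k \<inter> {x \<in> X0. nbhd E x \<inter> V k \<noteq> {}}" for k
  have Sb: "S k \<in> sets borel" for k unfolding S_def using X0_borel Vo by (intro sets.Int nbhd_meets_borel) auto
  have "X0 \<subseteq> (\<Union>k. S k)"
  proof
    fix x assume x: "x \<in> X0"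
    have "nbhd E x \<noteq> {}" using X0_deg[OF x] d by auto
    then obtain y where y: "y \<in> nbhd E x" by auto
    obtain i j where "x \<in> U i" "measure M (U i) < e" "y \<in> U j" "measure M (U j) < e" using small by blast
    then have "x \<in> V (prod_encode (i, j))" "y \<in> V (prod_encode (i, j))" unfolding V_def by auto
    then have "x \<in> S (prod_encode (i, j))" unfolding S_def using x y by auto
    then show "x \<in> (\<Union>k. S k)" by blast
  qed
  then obtain k where k: "0 < measure M (S k)" using cover_pos[of S] Sb by blast
  have "measure M (S k) \<le> measure M (V k)" using Vo sets_M by (intro finite_measure_mono) (auto simp: S_def)
  then have sm: "measure M (S k) < 1 / d" using Vm[of k] by simp
  have "m_L M E * (measure M (S k) - (measure M (S k))\<^sup>2) \<le> (real d - 1) * measure M (S k)"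
  proof (rule no_isolated_bound[OF Sb])
    fix x assume x: "x \<in> S k" "x \<in> X0"
    then obtain y where y: "E x y" "y \<in> V k" unfolding S_def nbhd_def by auto
    have "y \<in> S k" unfolding S_def nbhd_def using y x X0_closed[OF x(2) y(1)] sym_E[OF y(1)] unfolding S_def by auto
    then show "\<exists>y\<in>S k. E x y" using y by blast
  qed
  then have "(m_L M E * (1 - measure M (S k))) * measure M (S k) \<le> (real d - 1) * measure M (S k)"
    by (simp add: power2_eq_square algebra_simps)
  then have le: "m_L M E * (1 - measure M (S k)) \<le> real d - 1" using k by (rule mult_right_le_imp_le)
  show ?thesis
  proof (rule ccontr)
    assume "\<not> m_L M E < d"
    moreover have "0 \<le> 1 - measure M (S k)" by simp
    ultimately have "d * (1 - measure M (S k)) \<le> m_L M E * (1 - measure M (S k))" by (intro mult_right_mono) auto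
    moreover have "d * measure M (S k) < 1" using sm d by (simp add: field_simps)
    ultimately show False using le by (simp add: algebra_simps)
  qed
qed

end

section \<open>Odd components\<close>

locale separated_graph = structured_graph M E d X0 D \<phi> for M :: "'a::polish_space measure" and E d X0 D \<phi> +
  fixes A :: "'a set"
  assumes A_borel: "A \<in> sets borel" and atomless: "emeasure M {x} = 0"
begin

definition R where "R u v \<longleftrightarrow> E u v \<and> u \<notin> A \<and> v \<notin> A"

abbreviation comp where "comp \<equiv> comp_outside E A"

lemma comp_conv_R: "comp x = {y. R\<^sup>*\<^sup>* x y}"
  unfolding comp_outside_def R_def ..

lemma R_sym: "R\<^sup>*\<^sup>* x y \<Longrightarrow> R\<^sup>*\<^sup>* y x"
proof -
  have "symp R" unfolding R_def using sym_E by (auto intro: sympI)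
  then show "R\<^sup>*\<^sup>* x y \<Longrightarrow> R\<^sup>*\<^sup>* y x" by (metis sympD symp_rtranclp)
qed

lemma comp_eq: "y \<in> comp x \<Longrightarrow> comp y = comp x"
  unfolding comp_conv_R using R_sym by (auto intro: rtranclp_trans)

lemma comp_self: "x \<in> comp x"
  unfolding comp_conv_R by simp

lemma comp_X0: "R\<^sup>*\<^sup>* x y \<Longrightarrow> x \<in> X0 \<Longrightarrow> y \<in> X0"
  by (induction rule: rtranclp_induct) (use X0_closed in \<open>auto simp: R_def\<close>)

lemma comp_A: "R\<^sup>*\<^sup>* x y \<Longrightarrow> x \<notin> A \<Longrightarrow> y \<notin> A"
  by (induction rule: rtranclp_induct) (auto simp: R_def)

lemma comp_meets_borel:
  assumes V: "V \<in> sets borel"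
  shows "{x \<in> X0. comp x \<inter> V \<noteq> {}} \<in> sets borel"
proof -
  \<comment> \<open>\<open>S n\<close> collects the vertices with a path of length \<open>n\<close>
    to \<open>V\<close> outside \<open>A\<close>. Points of \<open>A\<close> may belong to
    \<open>S 0\<close>, being their own components, but no path passes through them.\<close>
  define S where "S = rec_nat (X0 \<inter> V) (\<lambda>_ S. {x \<in> X0. nbhd E x \<inter> (S - A) \<noteq> {}} - A)"
  have S0: "S 0 = X0 \<inter> V" and SS: "S (Suc n) = {x \<in> X0. nbhd E x \<inter> (S n - A) \<noteq> {}} - A" for n
    unfolding S_def by auto
  have Sb: "S n \<in> sets borel" for n
  proof (induction n)
    case 0 show ?case unfolding S0 using X0_borel V by auto
  next
    case (Suc n) then show ?case unfolding SS using A_borel by (intro sets.Diff nbhd_meets_borel) auto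
  qed
  have "S n \<subseteq> {x \<in> X0. comp x \<inter> V \<noteq> {}}" for n
  proof (induction n)
    case 0 show ?case unfolding S0 using comp_self by auto
  next
    case (Suc n)
    show ?case
    proof
      fix x assume "x \<in> S (Suc n)"
      then obtain y where y: "x \<in> X0" "R x y" "y \<in> S n" unfolding SS R_def nbhd_def by auto
      then have "comp y = comp x" by (intro comp_eq) (auto simp: comp_conv_R)
      then show "x \<in> {x \<in> X0. comp x \<inter> V \<noteq> {}}" using Suc y by auto
    qed
  qed
  moreover have "\<exists>n. x \<in> S n" if x: "R\<^sup>*\<^sup>* x y" "x \<in> X0" "y \<in> V" for x y
    using x(1,2)
  proof (induction rule: converse_rtranclp_induct)
    case base then have "y \<in> S 0" using x(3) unfolding S0 by auto
    then show ?case ..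
  next
    case (step x z)
    then have "z \<in> X0" using X0_closed unfolding R_def by blast
    then obtain n where "z \<in> S n" using step by blast
    then have "x \<in> S (Suc n)" unfolding SS using step(1,4) unfolding R_def nbhd_def by auto
    then show ?case ..
  qed
  ultimately have "{x \<in> X0. comp x \<inter> V \<noteq> {}} = (\<Union>n. S n)" unfolding comp_conv_R by fast
  then show ?thesis using Sb by auto
qed

text \<open>\<^const>\<open>measure\<close> is \<open>0\<close> on non-measurable sets, so only the Borel sets
  \<open>odd_comp_set E A k\<close> contribute to \<open>nu_O\<close>.\<close>

definition odd_part where
  "odd_part k = (if odd_comp_set E A k \<in> sets M then odd_comp_set E A k \<inter> X0 else {})"

definition odd_union where "odd_union = (\<Union>k. odd_part k)"

lemma odd_part_borel: "odd_part k \<in> sets borel"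
  unfolding odd_part_def using X0_borel sets_M by auto

lemma odd_union_borel: "odd_union \<in> sets borel"
  unfolding odd_union_def using odd_part_borel by auto

lemma measure_odd_part: "measure M (odd_part k) = measure M (odd_comp_set E A k)"
  unfolding odd_part_def using measure_X0_Int[of "odd_comp_set E A k"] sets_M
  by (auto simp: measure_notin_sets Int_commute)

lemma odd_unionD: "x \<in> odd_union \<Longrightarrow> x \<in> X0 \<and> x \<notin> A \<and> finite (comp x)"
  unfolding odd_union_def odd_part_def odd_comp_set_def by (auto split: if_splits)

lemma odd_union_closed: "x \<in> odd_union \<Longrightarrow> y \<in> comp x \<Longrightarrow> y \<in> odd_union"
  unfolding odd_union_def odd_part_def odd_comp_set_def
  using comp_eq[of y x] comp_A[of x y] comp_X0[of x y] by (auto simp: comp_conv_R split: if_splits)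

text \<open>Components of size at least 3 have weight at most 1/3. Isolated vertices have weight 1
  and carry the surplus 2/3.\<close>

lemma nu_O_le: "nu_O M E A \<le> 2 / 3 * measure M (odd_part 0) + 1 / 3 * measure M odd_union"
proof -
  have disj: "disjoint_family odd_part"
    unfolding disjoint_family_on_def odd_part_def odd_comp_set_def by auto
  have s: "(\<lambda>k. measure M (odd_part k)) sums measure M odd_union"
    unfolding odd_union_def using odd_part_borel disj sets_M by (intro finite_measure_UNION) auto
  define a where "a k = measure M (odd_part k)" for k
  define z where "z k = (if k = 0 then 2 / 3 * a 0 else 0)" for k :: nat
  have sz: "z sums (2 / 3 * a 0)" unfolding z_def by (rule sums_single)
  have sum: "(\<lambda>k. a k / 3 + z k) sums (measure M odd_union / 3 + 2 / 3 * a 0)"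
    using s unfolding a_def[symmetric] by (intro sums_add sums_divide sz)
  have le: "1 / real (2 * k + 1) * a k \<le> a k / 3 + z k" for k
  proof (cases "k = 0")
    case False
    then have "1 / real (2 * k + 1) * a k \<le> 1 / 3 * a k"
      by (intro mult_right_mono divide_left_mono) (auto simp: a_def)
    then show ?thesis using False unfolding z_def by simp
  qed (simp add: z_def)
  have nn: "0 \<le> 1 / real (2 * k + 1) * a k" for k unfolding a_def by simp
  have "summable (\<lambda>k. 1 / real (2 * k + 1) * a k)"
  proof (rule summable_comparison_test'[OF sums_summable[OF sum]])
    show "norm (1 / real (2 * k + 1) * a k) \<le> a k / 3 + z k" for k
      using le[of k] nn[of k] by (simp only: real_norm_def abs_of_nonneg)
  qed
  then have "(\<Sum>k. 1 / real (2 * k + 1) * a k) \<le> (\<Sum>k. a k / 3 + z k)"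
    using le sums_summable[OF sum] by (intro suminf_le) auto
  also have "\<dots> = measure M odd_union / 3 + 2 / 3 * a 0" by (rule sums_unique[OF sum, symmetric])
  finally show ?thesis unfolding nu_O_def a_def by (simp add: measure_odd_part)
qed

lemma odd_part_0_independent:
  assumes "x \<in> odd_part 0" "y \<in> odd_part 0" shows "\<not> E x y"
proof
  assume E: "E x y"
  have x: "x \<notin> A" "y \<notin> A" "card (comp x) = 1"
    using assms unfolding odd_part_def odd_comp_set_def by (auto split: if_splits)
  then have "y \<in> comp x" unfolding comp_conv_R R_def using E by auto
  then have "x = y" using x(3) comp_self by (metis card_1_singletonE singletonD)
  then show False using E irrefl_E by simp
qed

text \<open>Each finite component is given the least value of an injective Borel function on it. A
  value determines its component, which is finite and hence null, so the distribution of these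
  values is continuous. The intermediate value theorem then cuts at measure \<open>c\<close> without
  breaking a component.\<close>

lemma split_odd_union:
  assumes c: "0 < c" "c < measure M odd_union"
  obtains B where "B \<in> sets borel" "B \<subseteq> odd_union" "measure M B = c"
    "\<And>x y. x \<in> B \<Longrightarrow> y \<in> comp x \<Longrightarrow> y \<in> B"
proof -
  obtain h :: "'a \<Rightarrow> real" where h: "h \<in> borel_measurable borel" "inj h" by (rule ex_injective_borel_real)
  \<comment> \<open>This is the sublevel set of the component minimum, phrased through components
    meeting a Borel set so that \<open>comp_meets_borel\<close> applies.\<close>
  define T where "T t = odd_union \<inter> {x \<in> X0. comp x \<inter> h -` {..t} \<noteq> {}}" for t
  have Tb: "T t \<in> sets borel" for t
    unfolding T_def using measurable_sets[OF h(1), of "{..t}"] by (intro sets.Int odd_union_borel comp_meets_borel) auto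
  define \<tau> where "\<tau> x = Min (h ` comp x)" for x
  have T: "T t = {x \<in> odd_union. \<tau> x \<le> t}" for t
  proof (intro set_eqI)
    fix x
    have "\<tau> x \<le> t \<longleftrightarrow> (\<exists>y\<in>comp x. h y \<le> t)" if "x \<in> odd_union"
      unfolding \<tau>_def using odd_unionD[OF that] comp_self[of x] by (subst Min_le_iff) auto
    then show "x \<in> T t \<longleftrightarrow> x \<in> {x \<in> odd_union. \<tau> x \<le> t}" unfolding T_def using odd_unionD[of x] by blast
  qed
  \<comment> \<open>Off \<open>odd_union\<close> a component may be infinite, and its
    \<open>Min\<close> is then uncontrolled.\<close>
  define \<tau>' where "\<tau>' x = (if x \<in> odd_union then \<tau> x else 0)" for x
  have \<tau>'m: "\<tau>' \<in> borel_measurable borel"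
    unfolding borel_measurable_iff_le
  proof
    fix t
    have "{w \<in> space borel. \<tau>' w \<le> t} = T t \<union> (if 0 \<le> t then - odd_union else {})"
      unfolding T \<tau>'_def by auto
    then show "{w \<in> space borel. \<tau>' w \<le> t} \<in> sets borel" using Tb odd_union_borel by auto
  qed
  define N where "N = distr (density M (indicator odd_union)) borel \<tau>'"
  have m: "\<tau>' \<in> measurable (density M (indicator odd_union)) borel" using \<tau>'m by (simp add: borel_measurable_M)
  have N: "emeasure N Y = emeasure M (odd_union \<inter> \<tau>' -` Y)" if Y: "Y \<in> sets borel" for Y
  proof -
    have "\<tau>' -` Y \<in> sets M" using measurable_sets[OF \<tau>'m Y] sets_M by simp
    then show ?thesis
      unfolding N_def using m Y odd_union_borel sets_M by (simp add: emeasure_distr emeasure_restricted space_M)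
  qed
  then have N': "measure N Y = measure M (odd_union \<inter> \<tau>' -` Y)" if "Y \<in> sets borel" for Y
    using that by (simp add: measure_def)
  have "finite_borel_measure N"
  proof (intro finite_borel_measure.intro finite_measureI finite_borel_measure_axioms.intro)
    show "emeasure N (space N) \<noteq> \<infinity>" using N[of UNIV] unfolding N_def by (simp add: emeasure_eq_measure)
  qed (simp add: N_def)
  then interpret N: finite_borel_measure N .
  have cdfT: "cdf N t = measure M (T t)" for t
  proof -
    have "odd_union \<inter> \<tau>' -` {..t} = T t" unfolding T \<tau>'_def by auto
    then show ?thesis unfolding cdf_def by (simp add: N')
  qed
  have cont: "isCont (cdf N) t" for t
  proof -
    have "odd_union \<inter> \<tau>' -` {t} \<in> null_sets M"
    proof (cases "odd_union \<inter> \<tau>' -` {t} = {}")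
      case False
      then obtain x where "x \<in> odd_union" "\<tau>' x = t" by auto
      then have x: "x \<in> odd_union" "\<tau> x = t" unfolding \<tau>'_def by auto
      have min: "\<exists>y\<in>comp z. h y = \<tau> z" if "z \<in> odd_union" for z
      proof -
        have "Min (h ` comp z) \<in> h ` comp z"
          using odd_unionD[OF that] comp_self[of z] by (intro Min_in) auto
        then show ?thesis unfolding \<tau>_def by auto
      qed
      have "odd_union \<inter> \<tau>' -` {t} \<subseteq> comp x"
      proof
        fix z assume "z \<in> odd_union \<inter> \<tau>' -` {t}"
        then have z: "z \<in> odd_union" "\<tau> z = t" unfolding \<tau>'_def by auto
        obtain y y' where "y \<in> comp x" "h y = t" "y' \<in> comp z" "h y' = t" using min x z by metis
        then have "y' \<in> comp x" "y' \<in> comp z" using h(2) by (auto dest: injD)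
        then have "comp z = comp x" using comp_eq by metis
        then show "z \<in> comp x" using comp_self by auto
      qed
      moreover have "finite (comp x)" using odd_unionD[OF x(1)] by simp
      ultimately have "finite (odd_union \<inter> \<tau>' -` {t})" by (rule finite_subset)
      then have "countable (odd_union \<inter> \<tau>' -` {t})" by (rule countable_finite)
      moreover have "{z} \<in> null_sets M" for z using atomless sets_M by auto
      ultimately have "(\<Union>z\<in>odd_union \<inter> \<tau>' -` {t}. {z}) \<in> null_sets M" by (intro null_sets_UN') auto
      then show ?thesis by simp
    qed auto
    then have "measure N {t} = 0" using measure_eq_0_null_sets by (simp add: N')
    then show ?thesis by (simp add: N.isCont_cdf)
  qed
  have "eventually (\<lambda>t. cdf N t < c) at_bot"
    using N.cdf_lim_at_bot c(1) by (rule order_tendstoD)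
  then obtain t0 where t0: "cdf N t0 < c" by (metis eventually_happens trivial_limit_at_bot_linorder)
  have "measure N (space N) = measure M odd_union" using N'[of UNIV] unfolding N_def by simp
  then have "eventually (\<lambda>t. c < cdf N t) at_top"
    using N.cdf_lim_at_top c(2) by (metis order_tendstoD(1))
  then have "eventually (\<lambda>t. c < cdf N t \<and> t0 \<le> t) at_top"
    using eventually_ge_at_top by (rule eventually_conj)
  then obtain t1 where t1: "c < cdf N t1" "t0 \<le> t1" by (metis (no_types, lifting) eventually_happens trivial_limit_at_top_linorder)
  obtain t where "cdf N t = c"
    using IVT[of "cdf N" t0 c t1] t0 t1 cont by auto
  then have Tc: "measure M (T t) = c" using cdfT by simp
  have T_closed: "y \<in> T t" if "x \<in> T t" "y \<in> comp x" for x y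
  proof -
    have x: "x \<in> odd_union" "comp x \<inter> h -` {..t} \<noteq> {}" using that(1) unfolding T_def by auto
    have y: "y \<in> odd_union" using odd_union_closed[OF x(1) that(2)] .
    then have "y \<in> X0" using odd_unionD by blast
    then show ?thesis unfolding T_def using x(2) y comp_eq[OF that(2)] by simp
  qed
  have "T t \<subseteq> odd_union" unfolding T_def by blast
  from that[OF Tb this Tc T_closed] show ?thesis .
qed

section \<open>The Tutte inequality\<close>

lemma invariant_bound:
  assumes B: "B \<in> sets borel" "B \<subseteq> odd_union" and inv: "\<And>x y. x \<in> B \<Longrightarrow> y \<in> comp x \<Longrightarrow> y \<in> B"
    and m: "0 < m_L M E" and mM: "M_L M E \<le> 2 * m_L M E"
  shows "8 * measure M B * (1 - measure M A - measure M B) \<le> measure M A"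
proof -
  have BM: "B \<in> sets M" "A \<in> sets M" using B A_borel sets_M by auto
  have dis: "A \<inter> B = {}" using B(2) odd_unionD by blast
  have "measure M (- (A \<union> B)) = 1 - measure M (A \<union> B)"
    using prob_compl[of "A \<union> B"] BM space_M by (simp add: Compl_eq_Diff_UNIV)
  also have "measure M (A \<union> B) = measure M A + measure M B"
    using BM dis by (intro finite_measure_Union)
  finally have C: "measure M (- (A \<union> B)) = 1 - measure M A - measure M B" by simp
  \<comment> \<open>The second side takes all remaining components outside \<open>A\<close>, whether
    odd, even or infinite.\<close>
  have "8 * measure M B * measure M (- (A \<union> B)) \<le> 1 - measure M B - measure M (- (A \<union> B))"
  proof (rule separation_bound[OF B(1) _ _ _ m mM])
    show "- (A \<union> B) \<in> sets borel" using B A_borel by auto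
    fix x y assume x: "x \<in> X0" "x \<in> B" and y: "y \<in> - (A \<union> B)"
    show "\<not> E x y"
    proof
      assume "E x y"
      then have "R x y" unfolding R_def using x y odd_unionD B(2) by blast
      then have "y \<in> B" using inv[OF x(2)] unfolding comp_conv_R by auto
      then show False using y by simp
    qed
  qed auto
  then show ?thesis unfolding C by simp
qed

lemma tutte_bound:
  assumes m: "0 < m_L M E" and mM: "M_L M E \<le> 2 * m_L M E" and md: "m_L M E < d"
  shows "nu_O M E A \<le> max (1 / 2) (1 / 3 + 4 / 3 * max 0 (1 - d / (2 * m_L M E))) * measure M A"
proof -
  define a where "a = measure M A"
  define q where "q = measure M odd_union"
  define v where "v = measure M (odd_part 0)"
  define \<eta> where "\<eta> = max 0 (1 - d / (2 * m_L M E))"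
  have nn: "0 \<le> a" "0 \<le> v" "0 \<le> q" unfolding a_def v_def q_def by auto
  have "q + a = measure M (odd_union \<union> A)"
    unfolding q_def a_def using odd_union_borel A_borel sets_M odd_unionD by (intro finite_measure_Union[symmetric]) auto
  then have qa: "q + a \<le> 1" by simp
  have vq: "v \<le> q"
    unfolding v_def q_def using odd_union_borel sets_M by (intro finite_measure_mono) (auto simp: odd_union_def)
  have nu: "nu_O M E A \<le> 2 / 3 * v + 1 / 3 * q" using nu_O_le unfolding v_def q_def .
  have "nu_O M E A \<le> 1 / 2 * a \<or> nu_O M E A \<le> (1 / 3 + 4 / 3 * \<eta>) * a"
  proof (cases "q < (1 - a) / 2")
    case True
    have *: "8 * q * (1 - a - q) \<le> a"
      unfolding q_def a_def by (rule invariant_bound[OF odd_union_borel order_refl odd_union_closed m mM])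
    have "4 * q * (1 - a) \<le> 8 * q * (1 - a - q)"
      using mult_left_mono[of "(1 - a) / 2" "1 - a - q" "8 * q"] True nn by simp
    with * have **: "4 * q * (1 - a) \<le> a" by simp
    have "q \<le> a / 2"
    \<comment> \<open>For \<open>a > 1 / 2\<close> the case assumption alone gives
      \<open>q < 1 / 4 < a / 2\<close>.\<close>
    proof (cases "a \<le> 1 / 2")
      case True
      then have "4 * q * (1 / 2) \<le> 4 * q * (1 - a)" using nn by (intro mult_left_mono) auto
      with ** show ?thesis by simp
    qed (use \<open>q < (1 - a) / 2\<close> in simp)
    then show ?thesis using nu vq by simp
  next
    case False
    have "1 / 2 \<le> a"
    proof (cases "a = 1")
      case False
      then have a1: "a < 1" using qa nn by simp
      have "\<exists>B. B \<in> sets borel \<and> B \<subseteq> odd_union \<and> measure M B = (1 - a) / 2 \<and> (\<forall>x y. x \<in> B \<longrightarrow> y \<in> comp x \<longrightarrow> y \<in> B)"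
      proof (cases "q = (1 - a) / 2")
        case True
        then show ?thesis using odd_union_borel odd_union_closed unfolding q_def by (intro exI[of _ odd_union]) auto
      next
        case False
        then have "(1 - a) / 2 < measure M odd_union" using \<open>\<not> q < (1 - a) / 2\<close> unfolding q_def by simp
        with split_odd_union[of "(1 - a) / 2"] a1 show ?thesis by (metis diff_gt_0_iff_gt half_gt_zero)
      qed
      then obtain B where B: "B \<in> sets borel" "B \<subseteq> odd_union" "measure M B = (1 - a) / 2"
        "\<And>x y. x \<in> B \<Longrightarrow> y \<in> comp x \<Longrightarrow> y \<in> B" by blast
      have le: "8 * ((1 - a) / 2) * (1 - a - (1 - a) / 2) \<le> a"
        using invariant_bound[OF B(1,2,4) m mM] unfolding B(3) a_def[symmetric] .
      have eq: "8 * ((1 - a) / 2) * (1 - a - (1 - a) / 2) = 2 * (1 - a)\<^sup>2"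
        by (simp add: power2_eq_square field_simps)
      from le have "2 * (1 - a)\<^sup>2 \<le> a" unfolding eq .
      \<comment> \<open>The quadratic inequality in factored form; the second factor is positive
        since \<open>a < 1\<close>.\<close>
      then have "(2 * a - 1) * (2 - a) \<ge> 0" by (simp add: power2_eq_square algebra_simps)
      then have "2 * a - 1 \<ge> 0" using a1 by (simp add: zero_le_mult_iff)
      then show ?thesis by simp
    qed simp
    have "d * v \<le> M_L M E * (v - v\<^sup>2)"
      unfolding v_def by (rule independent_bound[OF odd_part_borel]) (use odd_part_0_independent in blast)
    also have "\<dots> \<le> 2 * m_L M E * (v - v\<^sup>2)"
    proof (rule mult_right_mono[OF mM])
      have "v * v \<le> v * 1" using nn qa vq by (intro mult_left_mono) auto
      then show "0 \<le> v - v\<^sup>2" by (simp add: power2_eq_square)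
    qed
    finally have dv: "v * d \<le> v * (2 * m_L M E * (1 - v))" by (simp add: power2_eq_square algebra_simps)
    \<comment> \<open>Hoffman's bound is divided by \<open>v\<close>; the case \<open>v = 0\<close>
      is covered by the maximum with 0 in \<open>\<eta>\<close>.\<close>
    have "v \<le> \<eta>"
    proof (cases "v = 0")
      case False
      then have "0 < v" using nn by simp
      with dv have "d \<le> 2 * m_L M E * (1 - v)" by (rule mult_left_le_imp_le)
      then have "d / (2 * m_L M E) \<le> 1 - v" using m by (simp add: field_simps)
      then show ?thesis unfolding \<eta>_def by simp
    qed (simp add: \<eta>_def)
    \<comment> \<open>Here \<open>q \<le> 1 - a \<le> 1 / 2\<close>. Writing the bound as a multiple
      of \<open>1 / 2\<close>, which is at most \<open>a\<close>, produces the constant.\<close>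
    then have "2 / 3 * v + 1 / 3 * q \<le> 2 / 3 * \<eta> + 1 / 3 * (1 / 2)" using qa \<open>1 / 2 \<le> a\<close> by simp
    also have "\<dots> = (1 / 3 + 4 / 3 * \<eta>) * (1 / 2)" by simp
    also have "\<dots> \<le> (1 / 3 + 4 / 3 * \<eta>) * a" using \<open>1 / 2 \<le> a\<close> unfolding \<eta>_def by (intro mult_left_mono) auto
    finally show ?thesis using nu by simp
  qed
  moreover have "1 / 2 * a \<le> max (1 / 2) (1 / 3 + 4 / 3 * \<eta>) * a" "(1 / 3 + 4 / 3 * \<eta>) * a \<le> max (1 / 2) (1 / 3 + 4 / 3 * \<eta>) * a"
    using nn by (intro mult_right_mono max.cobounded1 max.cobounded2; simp)+
  ultimately show ?thesis unfolding \<eta>_def a_def by linarith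
qed

end

theorem theorem7p6:
  fixes M :: "'a::polish_space measure" and E :: "'a \<Rightarrow> 'a \<Rightarrow> bool" and d :: nat
  assumes "prob_space M"
    and "sets M = sets borel"
    and "\<forall>x. emeasure M {x} = 0"
    and "borel_graph E"
    and "regular_graph M E d"
    and "pmp_graph M E"
    and "ergodic_graph M E"
    and "2 * m_L M E \<ge> M_L M E"
  shows "strict_measurable_tutte M E"
proof -
  interpret prob_space M by fact
  interpret regular_pmp_graph M E d
  proof unfold_locales
    show "{p. E (fst p) (snd p)} \<in> sets borel" using assms(4) unfolding borel_graph_def borel_prod by simp
  qed (use assms in \<open>auto simp: borel_graph_def regular_graph_def\<close>)
  obtain X0 D \<phi> where "structured_graph M E d X0 D \<phi>" using exists_structured_graph by blast
  then interpret structured_graph M E d X0 D \<phi> .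
  have atomless: "emeasure M {x} = 0" for x using assms(3) by simp
  \<comment> \<open>Were \<open>d = 0\<close>, components inside \<open>X0\<close> would be single
    points and every Borel subset of \<open>X0\<close> invariant. Without atoms some of these have
    measure strictly between 0 and 1, against ergodicity.\<close>
  have "0 < d"
  proof (rule ccontr)
    assume "\<not> 0 < d"
    then have iso: "\<not> E x y" if "x \<in> X0" for x y using X0_deg[OF that] unfolding nbhd_def by auto
    obtain U :: "nat \<Rightarrow> 'a set" where U: "\<And>n. open (U n)" "\<And>x V. open V \<Longrightarrow> x \<in> V \<Longrightarrow> \<exists>n. x \<in> U n \<and> U n \<subseteq> V"
      by (rule basis_sequence, rule that, assumption, assumption)
    define S where "S n = (if measure M (U n) < 1 then X0 \<inter> U n else {})" for n
    have Sb: "S n \<in> sets borel" for n unfolding S_def using X0_borel U(1) by auto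
    have "X0 \<subseteq> (\<Union>n. S n)"
    proof
      fix x assume x: "x \<in> X0"
      obtain W where W: "open W" "x \<in> W" "measure M W < 1" using small_open_nbhd[OF atomless zero_less_one] by blast
      then obtain i where i: "x \<in> U i" "U i \<subseteq> W" using U(2) by blast
      have "measure M (U i) \<le> measure M W" using i W(1) sets_M by (intro finite_measure_mono) auto
      then show "x \<in> (\<Union>n. S n)" using i W x unfolding S_def by (intro UN_I[of i]) auto
    qed
    then obtain n where n: "0 < measure M (S n)" using cover_pos[of S] Sb by blast
    have "x = y" if "E\<^sup>*\<^sup>* x y" "x \<in> X0" for x y
      using that by (induction rule: converse_rtranclp_induct) (use iso in auto)
    then have "x \<in> S n \<longleftrightarrow> y \<in> S n" if "E\<^sup>*\<^sup>* x y" for x y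
      using that conn_sym[OF that] unfolding S_def by (metis Int_iff empty_iff)
    then have "emeasure M (S n) = 0 \<or> emeasure M (S n) = 1"
      using assms(7) Sb sets_M unfolding ergodic_graph_def by blast
    then have "measure M (S n) = 1" using n by (auto simp: measure_def)
    moreover have "measure M (S n) < 1"
      using U(1) sets_M finite_measure_mono[of "X0 \<inter> U n" "U n"] unfolding S_def by auto
    ultimately show False by simp
  qed
  have m: "0 < m_L M E" using spectral_gap_pos[OF \<open>0 < d\<close>] assms(8) by simp
  have md: "m_L M E < d" using spectral_gap_less_degree[OF \<open>0 < d\<close> atomless] .
  \<comment> \<open>A restatement of \<open>m_L < d\<close>. It keeps the independent-set term below
    1/2, the point at which \<open>1 / 3 + 4 / 3 * z\<close> reaches 1.\<close>
  have "1 / 2 < d / (2 * m_L M E)" using m md by (simp add: field_simps)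
  then have "max 0 (1 - d / (2 * m_L M E)) < 1 / 2" by linarith
  moreover have "max (1 / 2) (1 / 3 + 4 / 3 * z) < 1" if "z < 1 / 2" for z :: real
    using that by simp
  ultimately have "max (1 / 2) (1 / 3 + 4 / 3 * max 0 (1 - d / (2 * m_L M E))) < 1" by blast
  moreover have "nu_O M E A \<le> max (1 / 2) (1 / 3 + 4 / 3 * max 0 (1 - d / (2 * m_L M E))) * measure M A" if "A \<in> sets M" for A
  proof -
    interpret separated_graph M E d X0 D \<phi> A
      by unfold_locales (use that sets_M atomless in auto)
    show ?thesis using tutte_bound[OF m _ md] assms(8) by simp
  qed
  ultimately show ?thesis unfolding strict_measurable_tutte_def by blast
qed

end
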